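(* Fix an admissible leader policy $(\alpha,\theta)$ and a worst-case distortion $\psi$. Suppose each $c_i$ is $C^1$ and strictly convex, the backlog dynamics $dY_{i,t}=-u_{i,t}\,dt$ are decoupled across zones, and the exposure cost $\sum_i a_{i,t}\Gamma_i\rho_i(\hat X)Y_i$ is separable. Then the lower-level feedback-Nash (Wardrop) equilibrium $u^\star(t,w,p)$, $p=(\nabla_{Y_i}V_i)_i$, exists, is unique, and coincides with the unique minimiser of the strictly convex Beckmann program $$u^\star(t,w,p)=\arg\min_{u\in\prod_i[0,\bar u_i]}\Big\{\sum_{i=1}^N\big(c_i(u_i)-p_iu_i\big)+\sum_{\ell\in\mathcal L}\phi_\ell\Big(\sum_j\Phi_{\ell j}u_j\Big)\Big\},$$ which is the saturated feedback $$u_i^\star=\operatorname{Proj}_{[0,\bar u_i]}\Big[(c_i')^{-1}\Big(p_i-\sum_{\ell}\Phi_{\ell i}\,g_\ell(q_\ell)\Big)\Big],\qquad q_\ell=\sum_j\Phi_{\ell j}u^\star_j .$$ The map $p\mapsto u^\star(t,w,p)$ is single-valued and globally Lipschitz, with $\|\partial_pu^\star\|\le\|(\mathbf\Gamma-H)^{-1}\|$ on the congested cone, which is finite precisely when $\rho(\mathbf\Gamma^{-1}H)<1$.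
   Context: Zones are indexed by $i\in\{1,\dots,N\}$; $\mathcal L$ is a finite set of shared corridors; $\Phi\in\mathbb R_{\ge0}^{|\mathcal L|\times N}$ is the routing matrix, so the load on corridor $\ell$ is $q_\ell=\sum_i\Phi_{\ell i}u_i$. Zone $i$ has at-risk backlog $Y_i\ge0$ and egress rate $u_i\in[0,\bar u_i]$. Corridor $\ell$ has capacity $\kappa_\ell$ and penalty $\eta_\ell>0$; the per-user congestion exposure is $g_\ell(q)=\eta_\ell(q-\kappa_\ell)^+$ and the Beckmann potential is $\phi_\ell(q)=\int_0^qg_\ell(s)\,ds=\frac{\eta_\ell}{2}((q-\kappa_\ell)^+)^2$. The mobilisation costs $c_i$ also satisfy $c_i(0)=0$, $c_i'>0$. The leader's policy consists of a disclosure gain $\alpha_t\in\mathbb R^{m\times n}$ and ordered activation times $\theta=(\theta_1\le\dots\le\theta_K)$ in $[0,T]$ of $K$ tiers partitioning the zones; $k(i)$ is the tier of zone $i$ and $a_{i,t}=\mathbf 1\{t\ge\theta_{k(i)}\}$. $\psi$ is a drift distortion of the belief mean. The state is $w=(\hat X,Y,\Pi)\in\mathbb R^n\times\mathbb R^N\times\mathbb S^n_+$ (belief mean, backlogs, belief covariance). $\rho_i(\hat X)\ge0$ is the believed hazard at zone $i$, $\Gamma_i>0$ its risk aversion, $\Theta_i$ the terminal price. Zone $i$'s private cost is $$J_i=\mathbb E\Big[\int_0^T\Big(a_{i,t}\Gamma_i\rho_i(\hat X_t)Y_{i,t}+c_i(u_{i,t})+u_{i,t}\sum_{\ell}\Phi_{\ell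 i}g_\ell(q_{\ell,t})\Big)dt+\Theta_i\rho_i(X_T)Y_{i,T}\Big],$$ and $V_i$ is its value function. In a Wardrop equilibrium each zone takes the congestion price $\sum_\ell\Phi_{\ell i}g_\ell(q_\ell)$ as given, so the stationarity condition is $c_i'(u_i)+\sum_\ell\Phi_{\ell i}g_\ell(q_\ell)=p_i$ in the interior of the box, with the usual complementarity on the faces of $[0,\bar u_i]$. $\mathbf\Gamma=\operatorname{diag}(c_1'',\dots,c_N'')$ and $H=\Phi^\top\operatorname{diag}(\eta_\ell\mathbf 1\{q_\ell>\kappa_\ell\})\Phi$; $\rho(\cdot)$ applied to a matrix is the spectral radius. The congested cone is the congested regime $q_\ell>\kappa_\ell$. The paper's section containing this lemma works throughout in the regime $\rho(\mathbf\Gamma^{-1}H)<1$.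
   Formalization: The Lipschitz and derivative claims assume each c_i'' exists, is continuous and positive on the box; "finite precisely when ρ<1" is read as convergence of the Neumann series of Γ^{-1}H iff ρ<1, and, for ρ≤1, invertibility of Γ−H iff ρ<1. *)

theory Defs
  imports "HOL-Analysis.Analysis"
begin

text \<open>
  Zones are the elements of a finite type \<open>'z\<close>, corridors those of a finite type \<open>'l\<close>.
  A state \<open>(X, Y, S)\<close> consists of belief mean, backlogs and belief covariance.
\<close>

type_synonym ('z, 'n) state = "(real ^ 'n) \<times> (real ^ 'z) \<times> (real ^ 'n ^ 'n)"

definition state_space :: "('z::finite, 'n::finite) state set" where
  "state_space = {(X, Y, S). (\<forall>i. 0 \<le> Y $ i) \<and> transpose S = S \<and> (\<forall>x. 0 \<le> x \<bullet> (S *v x))}"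

record ('z, 'l, 'n) evacuation =
  routing :: "real ^ ('z::finite) ^ ('l::finite)"
  penalty :: "real ^ 'l"
  capacity :: "real ^ 'l"
  max_rate :: "real ^ 'z"
  mob_cost :: "'z \<Rightarrow> real \<Rightarrow> real"
  hazard :: "'z \<Rightarrow> real ^ ('n::finite) \<Rightarrow> real"
  risk_aversion :: "real ^ 'z"

definition load :: "('z::finite, 'l::finite, 'n::finite) evacuation \<Rightarrow> real ^ 'z \<Rightarrow> real ^ 'l" where
  "load M u = routing M *v u"

definition rate_box :: "('z::finite, 'l::finite, 'n::finite) evacuation \<Rightarrow> (real ^ 'z) set" where
  "rate_box M = {u. \<forall>i. 0 \<le> u $ i \<and> u $ i \<le> max_rate M $ i}"

definition exposure :: "('z::finite, 'l::finite, 'n::finite) evacuation \<Rightarrow> 'l \<Rightarrow> real \<Rightarrow> real" where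
  "exposure M l q = penalty M $ l * max 0 (q - capacity M $ l)"

definition beckmann_potential :: "('z::finite, 'l::finite, 'n::finite) evacuation \<Rightarrow> 'l \<Rightarrow> real \<Rightarrow> real" where
  "beckmann_potential M l q = integral {0..q} (exposure M l)"

definition congestion_price :: "('z::finite, 'l::finite, 'n::finite) evacuation \<Rightarrow> real ^ 'l \<Rightarrow> 'z \<Rightarrow> real" where
  "congestion_price M q i = (\<Sum>l\<in>UNIV. routing M $ l $ i * exposure M l (q $ l))"

definition beckmann_objective ::
    "('z::finite, 'l::finite, 'n::finite) evacuation \<Rightarrow> real ^ 'z \<Rightarrow> real ^ 'z \<Rightarrow> real" where
  "beckmann_objective M p u =
     (\<Sum>i\<in>UNIV. mob_cost M i (u $ i) - p $ i * u $ i) +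
     (\<Sum>l\<in>UNIV. beckmann_potential M l (load M u $ l))"

definition strictly_convex_on :: "'a::real_vector set \<Rightarrow> ('a \<Rightarrow> real) \<Rightarrow> bool" where
  "strictly_convex_on S f \<longleftrightarrow> convex S \<and>
     (\<forall>x\<in>S. \<forall>y\<in>S. \<forall>s. x \<noteq> y \<and> 0 < s \<and> s < 1 \<longrightarrow>
        f ((1 - s) *\<^sub>R x + s *\<^sub>R y) < (1 - s) * f x + s * f y)"

text \<open>
  A leader policy is a disclosure gain \<open>\<alpha>\<close>, on which no condition is imposed, together with
  activation times \<open>\<theta> 1, \<dots>, \<theta> K\<close>; \<open>tier i\<close> is the tier of zone \<open>i\<close>.
\<close>

definition admissible_policy :: "real \<Rightarrow> nat \<Rightarrow> (real \<Rightarrow> real ^ 'n ^ 'm) \<times> (nat \<Rightarrow> real) \<Rightarrow> bool" where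
  "admissible_policy T K \<pi> \<longleftrightarrow>
     (\<forall>k\<in>{1..K}. snd \<pi> k \<in> {0..T}) \<and> mono_on {1..K} (snd \<pi>)"

definition activation :: "(nat \<Rightarrow> real) \<Rightarrow> ('z \<Rightarrow> nat) \<Rightarrow> 'z \<Rightarrow> real \<Rightarrow> real" where
  "activation \<theta> tier i t = of_bool (\<theta> (tier i) \<le> t)"

definition running_cost ::
    "('z::finite, 'l::finite, 'n::finite) evacuation \<Rightarrow> ('z \<Rightarrow> real \<Rightarrow> real) \<Rightarrow> 'z \<Rightarrow> real \<Rightarrow>
     ('z, 'n) state \<Rightarrow> real ^ 'l \<Rightarrow> real \<Rightarrow> real" where
  "running_cost M a i t w q v = (case w of (X, Y, S) \<Rightarrow>
     a i t * risk_aversion M $ i * hazard M i X * Y $ i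
     + mob_cost M i v + v * congestion_price M q i)"

definition backlog_drift :: "real ^ 'z \<Rightarrow> real ^ 'z" where
  "backlog_drift u = - u"

text \<open>
  \<open>zone_hamiltonian\<close> is the expression minimised in the Hamilton-Jacobi-Bellman equation of
  zone \<open>i\<close>: \<open>g\<close> is the gradient of \<open>V i\<close> in the whole backlog vector, and \<open>b\<close> collects the time
  derivative of \<open>V i\<close> and the generator of the belief part, neither of which involves the rates.
  The loads \<open>q\<close> are a separate argument, so that a zone varying its own rate can take the
  congestion price as given.
\<close>

definition zone_hamiltonian ::
    "('z::finite, 'l::finite, 'n::finite) evacuation \<Rightarrow> ('z \<Rightarrow> real \<Rightarrow> real) \<Rightarrow> real \<Rightarrow> 'z \<Rightarrow>
     real \<Rightarrow> ('z, 'n) state \<Rightarrow> real ^ 'l \<Rightarrow> real ^ 'z \<Rightarrow> real ^ 'z \<Rightarrow> real" where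
  "zone_hamiltonian M a b i t w q g u =
     running_cost M a i t w q (u $ i) + g \<bullet> backlog_drift u + b"

definition wardrop_equilibrium ::
    "('z::finite, 'l::finite, 'n::finite) evacuation \<Rightarrow> ('z \<Rightarrow> real \<Rightarrow> real) \<Rightarrow> ('z \<Rightarrow> real) \<Rightarrow>
     real \<Rightarrow> ('z, 'n) state \<Rightarrow> ('z \<Rightarrow> real ^ 'z) \<Rightarrow> real ^ 'z \<Rightarrow> bool" where
  "wardrop_equilibrium M a b t w G u \<longleftrightarrow> u \<in> rate_box M \<and>
     (\<forall>i. \<forall>v\<in>{0..max_rate M $ i}.
        zone_hamiltonian M a (b i) i t w (load M u) (G i) u
        \<le> zone_hamiltonian M a (b i) i t w (load M u) (G i) (\<chi> j. if j = i then v else u $ j))"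

definition has_backlog_gradient ::
    "(real \<Rightarrow> ('z::finite, 'n::finite) state \<Rightarrow> real) \<Rightarrow> real ^ 'z \<Rightarrow> real \<Rightarrow> ('z, 'n) state \<Rightarrow> bool" where
  "has_backlog_gradient V g t w \<longleftrightarrow> (case w of (X, Y, S) \<Rightarrow>
     ((\<lambda>Y'. V t (X, Y', S)) has_derivative (\<lambda>h. g \<bullet> h)) (at Y within {Y'. \<forall>j. 0 \<le> Y' $ j}))"

text \<open>
  The two inequalities give equality in the interior of the box and the complementarity
  conditions on its faces; \<open>c'\<close> is the family of marginal costs.
\<close>

definition wardrop_stationary ::
    "('z::finite, 'l::finite, 'n::finite) evacuation \<Rightarrow> ('z \<Rightarrow> real \<Rightarrow> real) \<Rightarrow>
     real ^ 'z \<Rightarrow> real ^ 'z \<Rightarrow> bool" where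
  "wardrop_stationary M c' p u \<longleftrightarrow> u \<in> rate_box M \<and>
     (\<forall>i. (u $ i < max_rate M $ i \<longrightarrow> p $ i \<le> c' i (u $ i) + congestion_price M (load M u) i) \<and>
          (0 < u $ i \<longrightarrow> c' i (u $ i) + congestion_price M (load M u) i \<le> p $ i))"

text \<open>
  A price outside the range of the increasing function \<open>f\<close> on \<open>[0, ub]\<close> is sent to an infinite
  value, which the projection then saturates at the corresponding face.
\<close>

definition marginal_inverse :: "(real \<Rightarrow> real) \<Rightarrow> real \<Rightarrow> real \<Rightarrow> ereal" where
  "marginal_inverse f ub y =
     (if y < f 0 then -\<infinity> else if f ub < y then \<infinity> else ereal (the_inv_into {0..ub} f y))"

definition box_proj :: "real \<Rightarrow> ereal \<Rightarrow> real" where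
  "box_proj ub x = real_of_ereal (max 0 (min (ereal ub) x))"

definition diag_mat :: "real ^ 'n \<Rightarrow> real ^ 'n ^ 'n" where
  "diag_mat d = (\<chi> i j. if i = j then d $ i else 0)"

definition cost_hessian :: "('z::finite \<Rightarrow> real \<Rightarrow> real) \<Rightarrow> real ^ 'z \<Rightarrow> real ^ 'z ^ 'z" where
  "cost_hessian c'' u = diag_mat (\<chi> i. c'' i (u $ i))"

definition congestion_hessian ::
    "('z::finite, 'l::finite, 'n::finite) evacuation \<Rightarrow> real ^ 'l \<Rightarrow> real ^ 'z ^ 'z" where
  "congestion_hessian M q =
     transpose (routing M)
       ** diag_mat (\<chi> l. penalty M $ l * of_bool (capacity M $ l < q $ l)) ** routing M"

definition congested :: "('z::finite, 'l::finite, 'n::finite) evacuation \<Rightarrow> real ^ 'l \<Rightarrow> bool" where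
  "congested M q \<longleftrightarrow> (\<forall>l. capacity M $ l < q $ l)"

definition strictly_complementary ::
    "('z::finite, 'l::finite, 'n::finite) evacuation \<Rightarrow> ('z \<Rightarrow> real \<Rightarrow> real) \<Rightarrow>
     real ^ 'z \<Rightarrow> real ^ 'z \<Rightarrow> bool" where
  "strictly_complementary M c' p u \<longleftrightarrow>
     (\<forall>i. u $ i = 0 \<or> u $ i = max_rate M $ i \<longrightarrow>
        c' i (u $ i) + congestion_price M (load M u) i \<noteq> p $ i)"

definition spectral_radius :: "real ^ 'n ^ 'n \<Rightarrow> real" where
  "spectral_radius A = Sup {cmod k | k.
     \<exists>v :: complex ^ 'n. v \<noteq> 0 \<and> (\<chi> i j. complex_of_real (A $ i $ j)) *v v = k *s v}"

definition op_norm :: "real ^ 'n ^ 'm \<Rightarrow> real" where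
  "op_norm A = onorm (\<lambda>x. A *v x)"

text \<open>
  The iteration is spelled out with \<open>*v\<close>, because \<open>^\<close> on the type of matrices is componentwise.
\<close>

definition neumann_converges :: "real ^ 'n ^ 'n \<Rightarrow> bool" where
  "neumann_converges A \<longleftrightarrow> (\<forall>x. summable (\<lambda>k. ((\<lambda>y. A *v y) ^^ k) x))"

end

theory Submission
  imports Defs
begin

text \<open>
  The whole argument rests on one observation: the Beckmann objective is a potential of the game.
  Its gradient in the rate of zone \<open>i\<close> is \<open>c\<^sub>i'(u\<^sub>i) + (congestion price) - p\<^sub>i\<close>, the marginal private cost of that
  zone when it takes the congestion price as given. Both the minimisers of the potential over the
  box and the Wardrop equilibria are therefore the solutions of the same variational inequality
  \<open>0 \<le> \<nabla>F(u) \<bullet> (v - u)\<close> for all \<open>v\<close> in the box, which, the box being a product, splits into the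
  stationarity and complementarity conditions of the single zones. No derivative of the
  potential is ever taken. Convexity enters only through the inequality
  \<open>F(u) + \<nabla>F(u) \<bullet> (v - u) \<le> F(v)\<close>, strict for \<open>u \<noteq> v\<close> (\<open>beckmann_objective_above_tangent\<close>), and continuity of
  \<open>\<nabla>F\<close>; a minimiser satisfies the inequality with \<open>\<nabla>F(v)\<close> in place of \<open>\<nabla>F(u)\<close>, and Minty's
  trick (\<open>minty_variational_inequality\<close>) moves the gradient to \<open>u\<close>. Compactness of the box gives
  existence and strict convexity gives uniqueness; the projection formula is a case distinction
  on the stationarity condition.

  The congestion price is a monotone function of the rates, so that two equilibria satisfy
  \<open>\<Sum>\<^sub>i (c\<^sub>i'(u\<^sub>i) - c\<^sub>i'(v\<^sub>i)) (u\<^sub>i - v\<^sub>i) \<le> (p - p') \<bullet> (u - v)\<close> (\<open>wardrop_stationary_monotone\<close>). A lower bound \<open>m\<close>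
  of the curvatures \<open>c\<^sub>i''\<close> on the box makes \<open>1/m\<close> a global Lipschitz constant; used near a single
  price with the curvatures at the equilibrium only, the same inequality bounds every derivative \<open>D\<close>
  of the equilibrium map by \<open>1 / min\<^sub>i c\<^sub>i''(u\<^sub>i)\<close>. As \<open>H\<close> is positive semidefinite, the smallest
  eigenvalue of \<open>\<Gamma> - H\<close> is at most \<open>min\<^sub>i c\<^sub>i''(u\<^sub>i)\<close>, which turns this bound into
  \<open>\<parallel>D\<parallel> \<le> \<parallel>(\<Gamma> - H)\<^sup>-\<^sup>1\<parallel>\<close> as soon as \<open>\<Gamma> - H\<close> is positive definite.

  The condition on the spectral radius is a statement about the symmetric pencil \<open>(\<Gamma>, H)\<close>: the matrix
  \<open>\<Gamma>\<^sup>-\<^sup>1H\<close> is self-adjoint for the inner product of \<open>\<Gamma>\<close>, hence its spectral radius is the maximum \<open>\<lambda>\<close>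
  of the quotients \<open>(x \<bullet> Hx) / (x \<bullet> \<Gamma>x)\<close>, and \<open>\<lambda>\<close> is an eigenvalue. From \<open>\<lambda> < 1\<close> follow positive
  definiteness of \<open>\<Gamma> - H\<close> and geometric decay of the iterates of \<open>\<Gamma>\<^sup>-\<^sup>1H\<close>; for \<open>\<lambda> \<ge> 1\<close> the eigenvector
  refutes convergence, and for \<open>\<lambda> = 1\<close> also invertibility.

  Finally, at a congested and strictly complementary equilibrium the saturated zones stay saturated
  and the corridors stay congested for nearby prices. The remaining zones satisfy equations whose
  linearisation has a positive definite matrix, and inverting it yields the derivative
  (\<open>equilibrium_differentiable\<close>).
\<close>

section \<open>Convexity and variational inequalities\<close>

text \<open>
  The derivative is one-sided when \<open>x\<close> is an endpoint, a case that matters because equilibrium rates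
  often lie on a face of the box. The weak inequality comes from difference quotients along the
  segment from \<open>x\<close>; applying it at the midpoint of \<open>x\<close> and \<open>y\<close>, where \<open>f\<close> lies strictly
  below the chord, makes it strict.
\<close>
lemma strictly_convex_above_tangent:
  fixes f :: "real \<Rightarrow> real"
  assumes conv: "strictly_convex_on {a..b} f"
    and deriv: "(f has_real_derivative d) (at x within {a..b})"
    and x: "x \<in> {a..b}" and y: "y \<in> {a..b}" and "x \<noteq> y"
  shows "f x + d * (y - x) < f y"
proof -
  have below_chord: "f x + d * (z - x) \<le> f z" if z: "z \<in> {a..b}" "z \<noteq> x" for z
  proof -
    have "((\<lambda>w. (f w - f x) / (w - x)) \<longlongrightarrow> d) (at x within {a..b})"
      using deriv by (simp add: has_field_derivative_iff)
    moreover have "filterlim (\<lambda>s. x + s * (z - x)) (at x within {a..b}) (at_right 0)"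
    proof -
      have "((\<lambda>s. x + s * (z - x)) \<longlongrightarrow> x + 0 * (z - x)) (at_right 0)"
        by (intro tendsto_intros)
      moreover have "eventually (\<lambda>s::real. s \<in> {0<..<1}) (at_right 0)"
        by (rule eventually_at_right_real) simp
      then have "eventually (\<lambda>s. x + s * (z - x) \<in> {a..b} \<and> x + s * (z - x) \<noteq> x) (at_right 0)"
      proof eventually_elim
        case (elim s)
        have "(1 - s) *\<^sub>R x + s *\<^sub>R z \<in> {a..b}"
          using elim x z by (intro convexD[OF convex_real_interval(5)]) auto
        then show ?case using elim z by (simp add: algebra_simps)
      qed
      ultimately show ?thesis
        by (simp add: filterlim_at)
    qed
    ultimately have lim: "((\<lambda>s. (f (x + s * (z - x)) - f x) / (s * (z - x))) \<longlongrightarrow> d) (at_right 0)"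
      using filterlim_compose by fastforce
    have "((\<lambda>s. (f (x + s * (z - x)) - f x) / (s * (z - x)) * (z - x)) \<longlongrightarrow> d * (z - x)) (at_right 0)"
      by (intro tendsto_intros lim)
    moreover have "eventually (\<lambda>s::real. s \<in> {0<..<1}) (at_right 0)"
      by (rule eventually_at_right_real) simp
    then have "eventually (\<lambda>s. (f (x + s * (z - x)) - f x) / (s * (z - x)) * (z - x) \<le> f z - f x)
        (at_right 0)"
    proof eventually_elim
      case (elim s)
      have "f ((1 - s) *\<^sub>R x + s *\<^sub>R z) < (1 - s) * f x + s * f z"
        using conv x z elim by (auto simp: strictly_convex_on_def)
      then have "f (x + s * (z - x)) - f x \<le> s * (f z - f x)"
        by (simp add: algebra_simps)
      then have "(f (x + s * (z - x)) - f x) / s \<le> f z - f x"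
        using elim by (simp add: divide_le_eq mult.commute)
      then show ?case using z by simp
    qed
    ultimately have "d * (z - x) \<le> f z - f x"
      by (rule tendsto_upperbound) simp
    then show ?thesis by simp
  qed
  define m where "m = (x + y) / 2"
  have m: "m \<in> {a..b}" "m \<noteq> x" using x y \<open>x \<noteq> y\<close> by (auto simp: m_def)
  have "f x + d * (y - x) / 2 = f x + d * (m - x)"
    by (simp add: m_def field_simps)
  also have "\<dots> \<le> f m" by (rule below_chord[OF m])
  also have "f m = f ((1 - 1/2) *\<^sub>R x + (1/2) *\<^sub>R y)" by (simp add: m_def field_simps)
  also have "\<dots> < (1 - 1/2) * f x + (1/2) * f y"
    using conv x y \<open>x \<noteq> y\<close> unfolding strictly_convex_on_def by (smt (verit) field_sum_of_halves)
  finally show ?thesis by (simp add: field_simps)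
qed

text \<open>
  Minty's trick: test the hypothesis with \<open>v = u + s(w - u)\<close>, cancel the factor \<open>s > 0\<close> and let \<open>s\<close>
  tend to zero. It is what allows minimisers to be treated without differentiating the objective.
\<close>
lemma minty_variational_inequality:
  fixes g :: "'a::real_inner \<Rightarrow> 'a"
  assumes "convex S" "continuous_on S g" and u: "u \<in> S"
    and dual: "\<And>v. v \<in> S \<Longrightarrow> 0 \<le> g v \<bullet> (v - u)" and w: "w \<in> S"
  shows "0 \<le> g u \<bullet> (w - u)"
proof -
  define z where "z s = u + s *\<^sub>R (w - u)" for s :: real
  have zS: "z s \<in> S" if "s \<in> {0..1}" for s
  proof -
    have "(1 - s) *\<^sub>R u + s *\<^sub>R w \<in> S"
      using that u w by (intro convexD[OF \<open>convex S\<close>]) auto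
    then show ?thesis by (simp add: z_def algebra_simps)
  qed
  have "continuous_on {0..1} (\<lambda>s. g (z s))"
    unfolding z_def
    by (rule continuous_on_compose2[OF \<open>continuous_on S g\<close>])
      (use zS in \<open>auto simp: z_def intro!: continuous_intros\<close>)
  then have "continuous_on {0..1} (\<lambda>s. g (z s) \<bullet> (w - u))"
    by (intro continuous_intros)
  then have lim: "((\<lambda>s. g (z s) \<bullet> (w - u)) \<longlongrightarrow> g (z 0) \<bullet> (w - u)) (at 0 within {0..1})"
    by (auto simp: continuous_on_def)
  have "at (0::real) within {0..1} = at_right 0"
    by (rule at_within_Icc_at_right) simp
  then have lim': "((\<lambda>s. g (z s) \<bullet> (w - u)) \<longlongrightarrow> g u \<bullet> (w - u)) (at_right 0)"
    using lim by (simp add: z_def)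
  have "eventually (\<lambda>s::real. s \<in> {0<..<1}) (at_right 0)"
    by (rule eventually_at_right_real) simp
  then have "eventually (\<lambda>s. 0 \<le> g (z s) \<bullet> (w - u)) (at_right 0)"
  proof eventually_elim
    case (elim s)
    have "0 \<le> g (z s) \<bullet> (z s - u)" using elim by (intro dual zS) auto
    then have "0 \<le> s * (g (z s) \<bullet> (w - u))" by (simp add: z_def)
    then show ?case using elim by (simp add: zero_le_mult_iff)
  qed
  then show ?thesis by (rule tendsto_lowerbound[OF lim']) simp
qed

section \<open>Congestion exposure and loads\<close>

lemma exposure_mono: "0 \<le> penalty M $ l \<Longrightarrow> mono (exposure M l)"
  unfolding exposure_def by (intro monoI mult_left_mono) auto

lemma exposure_continuous: "continuous_on S (exposure M l)"
  unfolding exposure_def[abs_def] by (intro continuous_intros)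

text \<open>
  The potential is an integral of a nondecreasing function, so its increment is compared with that
  of the constant value at \<open>a\<close>, in either direction of integration. Nonnegativity of the arguments
  is essential: the potential is constantly \<open>0\<close> on negative loads, where the integration
  interval is empty.
\<close>
lemma beckmann_potential_above_tangent:
  assumes "0 \<le> penalty M $ l" "0 \<le> a" "0 \<le> b"
  shows "beckmann_potential M l a + exposure M l a * (b - a) \<le> beckmann_potential M l b"
proof -
  have int: "exposure M l integrable_on {x..y}" for x y
    by (intro integrable_continuous_interval exposure_continuous)
  have diff: "beckmann_potential M l y - beckmann_potential M l x = integral {x..y} (exposure M l)"
    if "0 \<le> x" "x \<le> y" for x y
    using Henstock_Kurzweil_Integration.integral_combine[OF that int] by (simp add: beckmann_potential_def)
  note mono = monoD[OF exposure_mono[OF assms(1)]]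
  show ?thesis
  proof (cases "a \<le> b")
    case True
    have "integral {a..b} (\<lambda>_. exposure M l a) \<le> integral {a..b} (exposure M l)"
      by (intro integral_le int) (auto intro: mono)
    then show ?thesis using diff[OF \<open>0 \<le> a\<close> True] True by (simp add: algebra_simps)
  next
    case False
    have "integral {b..a} (exposure M l) \<le> integral {b..a} (\<lambda>_. exposure M l a)"
      by (intro integral_le int) (auto intro: mono)
    then show ?thesis using diff[of b a] False \<open>0 \<le> b\<close> by (simp add: algebra_simps)
  qed
qed

lemma load_nth: "load M u $ l = (\<Sum>j\<in>UNIV. routing M $ l $ j * u $ j)"
  by (simp add: load_def matrix_vector_mult_def)

lemma load_diff: "load M u - load M v = load M (u - v)"
  by (simp add: load_def matrix_vector_mult_diff_distrib)

text \<open>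
  Prices are the adjoint image of exposures under the routing matrix. This identity makes the
  Beckmann objective a potential of the game.
\<close>
lemma congestion_price_dual_load:
  "(\<Sum>i\<in>UNIV. congestion_price M q i * h $ i) = (\<Sum>l\<in>UNIV. exposure M l (q $ l) * load M h $ l)"
proof -
  have "(\<Sum>i\<in>UNIV. congestion_price M q i * h $ i)
      = (\<Sum>i\<in>UNIV. \<Sum>l\<in>UNIV. exposure M l (q $ l) * (routing M $ l $ i * h $ i))"
    by (simp add: congestion_price_def sum_distrib_left sum_distrib_right mult_ac)
  also have "\<dots> = (\<Sum>l\<in>UNIV. \<Sum>i\<in>UNIV. exposure M l (q $ l) * (routing M $ l $ i * h $ i))"
    by (rule sum.swap)
  finally show ?thesis by (simp add: load_nth sum_distrib_left)
qed

lemma rate_box_eq_cbox: "rate_box M = cbox 0 (max_rate M)"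
  by (auto simp: rate_box_def mem_box_cart)

lemma compact_rate_box: "compact (rate_box M)"
  and convex_rate_box: "convex (rate_box M)"
  by (simp_all add: rate_box_eq_cbox)

text \<open>
  This is the gradient of the Beckmann objective and, at the same time, the vector of marginal
  private costs of the zones at a given congestion price.
\<close>
definition beckmann_gradient ::
  "('z::finite, 'l::finite, 'n::finite) evacuation \<Rightarrow> ('z \<Rightarrow> real \<Rightarrow> real) \<Rightarrow>
    real ^ 'z \<Rightarrow> real ^ 'z \<Rightarrow> real ^ 'z" where
  "beckmann_gradient M c' p u = (\<chi> i. c' i (u $ i) + congestion_price M (load M u) i - p $ i)"

lemma beckmann_gradient_inner:
  "beckmann_gradient M c' p u \<bullet> h =
    (\<Sum>i\<in>UNIV. (c' i (u $ i) - p $ i) * h $ i) + (\<Sum>l\<in>UNIV. exposure M l (load M u $ l) * load M h $ l)"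
  unfolding congestion_price_dual_load[symmetric]
  by (simp add: inner_vec_def beckmann_gradient_def sum.distrib[symmetric] algebra_simps)

section \<open>The Beckmann program as a potential of the game\<close>

locale evacuation_game =
  fixes M :: "('z::finite, 'l::finite, 'n::finite) evacuation"
    and c' :: "'z \<Rightarrow> real \<Rightarrow> real"
  assumes routing_nonneg: "\<And>l i. 0 \<le> routing M $ l $ i"
    and penalty_nonneg: "\<And>l. 0 \<le> penalty M $ l"
    and max_rate_nonneg: "\<And>i. 0 \<le> max_rate M $ i"
    and cost_deriv: "\<And>i v. v \<in> {0..max_rate M $ i} \<Longrightarrow>
      (mob_cost M i has_real_derivative c' i v) (at v within {0..max_rate M $ i})"
    and cost_C1: "\<And>i. continuous_on {0..max_rate M $ i} (c' i)"
    and cost_convex: "\<And>i. strictly_convex_on {0..max_rate M $ i} (mob_cost M i)"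
begin

lemma rate_boxD: "u \<in> rate_box M \<Longrightarrow> u $ i \<in> {0..max_rate M $ i}"
  by (simp add: rate_box_def)

lemma cost_above_tangent:
  assumes "x \<in> {0..max_rate M $ i}" "y \<in> {0..max_rate M $ i}"
  shows "x \<noteq> y \<Longrightarrow> mob_cost M i x + c' i x * (y - x) < mob_cost M i y"
    and "mob_cost M i x + c' i x * (y - x) \<le> mob_cost M i y"
  using strictly_convex_above_tangent[OF cost_convex cost_deriv[OF assms(1)] assms]
  by (cases "x = y"; force)+

lemma marginal_cost_strict_mono: "strict_mono_on {0..max_rate M $ i} (c' i)"
proof (rule strict_mono_onI)
  fix x y assume *: "x \<in> {0..max_rate M $ i}" "y \<in> {0..max_rate M $ i}" "x < y"
  have "c' i x * (y - x) < c' i y * (y - x)"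
    using cost_above_tangent(1)[of x i y] cost_above_tangent(1)[of y i x] *
    by (simp add: algebra_simps)
  then show "c' i x < c' i y" using * by simp
qed

lemma load_nonneg: "u \<in> rate_box M \<Longrightarrow> 0 \<le> load M u $ l"
  by (auto simp: load_nth rate_box_def intro!: sum_nonneg mult_nonneg_nonneg routing_nonneg)

lemma beckmann_objective_above_tangent:
  assumes u: "u \<in> rate_box M" and v: "v \<in> rate_box M"
  shows "u \<noteq> v \<Longrightarrow>
      beckmann_objective M p u + beckmann_gradient M c' p u \<bullet> (v - u) < beckmann_objective M p v"
    and "beckmann_objective M p u + beckmann_gradient M c' p u \<bullet> (v - u) \<le> beckmann_objective M p v"
proof -
  have pot: "(\<Sum>l\<in>UNIV. beckmann_potential M l (load M u $ l) + exposure M l (load M u $ l) * load M (v - u) $ l)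
      \<le> (\<Sum>l\<in>UNIV. beckmann_potential M l (load M v $ l))"
    using beckmann_potential_above_tangent[OF penalty_nonneg load_nonneg[OF u] load_nonneg[OF v]]
    by (intro sum_mono) (simp add: load_diff[symmetric])
  have le: "mob_cost M i (u $ i) - p $ i * u $ i + (c' i (u $ i) - p $ i) * (v - u) $ i
      \<le> mob_cost M i (v $ i) - p $ i * v $ i" for i
    using cost_above_tangent(2)[OF rate_boxD[OF u] rate_boxD[OF v], of i] by (simp add: algebra_simps)
  have cost: "(\<Sum>i\<in>UNIV. mob_cost M i (u $ i) - p $ i * u $ i + (c' i (u $ i) - p $ i) * (v - u) $ i)
      < (\<Sum>i\<in>UNIV. mob_cost M i (v $ i) - p $ i * v $ i)" if "u \<noteq> v"
  proof (rule sum_strict_mono_ex1)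
    obtain i where "u $ i \<noteq> v $ i" using \<open>u \<noteq> v\<close> by (auto simp: vec_eq_iff)
    then have "mob_cost M i (u $ i) - p $ i * u $ i + (c' i (u $ i) - p $ i) * (v - u) $ i
        < mob_cost M i (v $ i) - p $ i * v $ i"
      using cost_above_tangent(1)[OF rate_boxD[OF u] rate_boxD[OF v], of i] by (simp add: algebra_simps)
    then show "\<exists>i\<in>UNIV. mob_cost M i (u $ i) - p $ i * u $ i + (c' i (u $ i) - p $ i) * (v - u) $ i
        < mob_cost M i (v $ i) - p $ i * v $ i" by blast
  qed (use le in auto)
  show strict: "beckmann_objective M p u + beckmann_gradient M c' p u \<bullet> (v - u) < beckmann_objective M p v"
    if "u \<noteq> v"
    using pot cost[OF that] by (simp only: beckmann_objective_def beckmann_gradient_inner sum.distrib)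
  show "beckmann_objective M p u + beckmann_gradient M c' p u \<bullet> (v - u) \<le> beckmann_objective M p v"
  proof (cases "u = v")
    case False
    then show ?thesis using strict by simp
  qed simp
qed

text \<open>
  A function lying strictly above a tangent at each point of a convex set is strictly convex: combine
  the two inequalities at \<open>z = (1 - s) x + s y\<close>, where the linear terms cancel.
\<close>
lemma beckmann_objective_strictly_convex: "strictly_convex_on (rate_box M) (beckmann_objective M p)"
  unfolding strictly_convex_on_def
proof (intro conjI ballI allI impI convex_rate_box)
  fix x y s assume xy: "x \<in> rate_box M" "y \<in> rate_box M" and *: "x \<noteq> y \<and> 0 < s \<and> (s::real) < 1"
  define z where "z = (1 - s) *\<^sub>R x + s *\<^sub>R y"
  define F where "F = beckmann_objective M p"
  define g where "g = beckmann_gradient M c' p z"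
  have z: "z \<in> rate_box M" unfolding z_def
    using xy * by (intro convexD[OF convex_rate_box]) auto
  have zx: "x - z = (- s) *\<^sub>R (y - x)" and zy: "y - z = (1 - s) *\<^sub>R (y - x)"
    by (simp_all add: z_def algebra_simps)
  then have "z \<noteq> x" "z \<noteq> y" using * by auto
  then have "F z + g \<bullet> (x - z) < F x" "F z + g \<bullet> (y - z) < F y"
    using beckmann_objective_above_tangent(1)[OF z] xy by (auto simp: F_def g_def)
  then have "F z + (- s) * (g \<bullet> (y - x)) < F x" "F z + (1 - s) * (g \<bullet> (y - x)) < F y"
    unfolding zx zy by simp_all
  then have "(1 - s) * (F z + (- s) * (g \<bullet> (y - x))) < (1 - s) * F x"
    "s * (F z + (1 - s) * (g \<bullet> (y - x))) < s * F y" using * by simp_all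
  then have "F z < (1 - s) * F x + s * F y" by (simp add: algebra_simps)
  then show "F ((1 - s) *\<^sub>R x + s *\<^sub>R y) < (1 - s) * F x + s * F y" by (simp add: z_def)
qed

lemma beckmann_gradient_continuous: "continuous_on (rate_box M) (beckmann_gradient M c' p)"
proof -
  have "continuous_on (rate_box M) (\<lambda>u. c' i (u $ i))" for i
    by (rule continuous_on_compose2[OF cost_C1])
      (auto simp: rate_box_def intro!: continuous_intros)
  then show ?thesis
    unfolding beckmann_gradient_def[abs_def] congestion_price_def exposure_def load_def
    by (intro continuous_intros matrix_vector_mult_linear_continuous_on)
qed

end

section \<open>Definite matrices and symmetric pencils\<close>

definition pos_semidef :: "real ^ 'n ^ 'n::finite \<Rightarrow> bool" where
  "pos_semidef A \<longleftrightarrow> transpose A = A \<and> (\<forall>x. 0 \<le> x \<bullet> (A *v x))"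

definition pos_definite :: "real ^ 'n ^ 'n::finite \<Rightarrow> bool" where
  "pos_definite A \<longleftrightarrow> transpose A = A \<and> (\<forall>x. x \<noteq> 0 \<longrightarrow> 0 < x \<bullet> (A *v x))"

lemma symmetric_inner_commute:
  fixes A :: "real ^ 'n::finite ^ 'n"
  assumes "transpose A = A"
  shows "x \<bullet> (A *v y) = y \<bullet> (A *v x)"
  by (metis assms dot_lmul_matrix inner_commute transpose_matrix_vector)

lemma pos_definite_imp_semidef: "pos_definite A \<Longrightarrow> pos_semidef A"
  unfolding pos_definite_def pos_semidef_def by (metis inner_zero_left order.refl order_less_imp_le)

lemma pos_semidef_cauchy_schwarz:
  assumes "pos_semidef A"
  shows "(x \<bullet> (A *v y))\<^sup>2 \<le> (x \<bullet> (A *v x)) * (y \<bullet> (A *v y))"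
proof -
  define a b c where "a = x \<bullet> (A *v x)" and "b = x \<bullet> (A *v y)" and "c = y \<bullet> (A *v y)"
  have sym: "y \<bullet> (A *v x) = b"
    using assms symmetric_inner_commute unfolding pos_semidef_def b_def by blast
  have quad: "0 \<le> s\<^sup>2 * a + 2 * s * t * b + t\<^sup>2 * c" for s t
  proof -
    have "0 \<le> (s *\<^sub>R x + t *\<^sub>R y) \<bullet> (A *v (s *\<^sub>R x + t *\<^sub>R y))"
      using assms by (simp add: pos_semidef_def)
    also have "\<dots> = s\<^sup>2 * a + 2 * s * t * b + t\<^sup>2 * c"
      by (simp add: matrix_vector_right_distrib matrix_vector_mult_scaleR inner_add_left inner_add_right
          sym a_def[symmetric] b_def[symmetric] c_def[symmetric] power2_eq_square algebra_simps)
    finally show ?thesis .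
  qed
  have "0 \<le> a" "0 \<le> c" using quad[of 1 0] quad[of 0 1] by simp_all
  have "b\<^sup>2 \<le> a * c"
  proof (cases "a = 0")
    case True
    have "b = 0"
    proof (rule ccontr)
      assume "b \<noteq> 0"
      then show False using quad[of "- (c + 1) / (2 * b)" 1] True by (simp add: field_simps)
    qed
    then show ?thesis using True by simp
  next
    case False
    have "0 \<le> a * (a * c - b\<^sup>2)"
      using quad[of "- b" a] by (simp add: power2_eq_square algebra_simps)
    then show ?thesis using False \<open>0 \<le> a\<close> by (simp add: zero_le_mult_iff)
  qed
  then show ?thesis by (simp add: a_def b_def c_def)
qed

lemma pos_definite_invertible: "pos_definite A \<Longrightarrow> invertible A"
  unfolding invertible_left_inverse matrix_left_invertible_ker pos_definite_def
  by (metis inner_zero_right less_irrefl)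

lemma matrix_inv_inverse:
  fixes A :: "'a::semiring_1 ^ 'n ^ 'm"
  assumes "invertible A"
  shows "A ** matrix_inv A = mat 1" "matrix_inv A ** A = mat 1"
  using someI_ex[of "\<lambda>B. A ** B = mat 1 \<and> B ** A = mat 1"] assms
  by (simp_all add: invertible_def matrix_inv_def)

lemma pos_definite_lower_bound:
  fixes A :: "real ^ 'n::finite ^ 'n"
  assumes "pos_definite A"
  obtains m where "0 < m" "\<And>x. m * (norm x)\<^sup>2 \<le> x \<bullet> (A *v x)"
proof -
  have "\<exists>x0\<in>sphere (0::real^'n) 1. \<forall>x\<in>sphere 0 1. x0 \<bullet> (A *v x0) \<le> x \<bullet> (A *v x)"
    by (intro continuous_attains_inf continuous_intros matrix_vector_mult_linear_continuous_on) auto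
  then obtain x0 where x0: "norm x0 = 1" "\<And>x. norm x = 1 \<Longrightarrow> x0 \<bullet> (A *v x0) \<le> x \<bullet> (A *v x)"
    by auto
  show ?thesis
  proof
    have "x0 \<noteq> 0" using x0(1) by auto
    then show "0 < x0 \<bullet> (A *v x0)" using assms by (simp add: pos_definite_def)
    show "x0 \<bullet> (A *v x0) * (norm x)\<^sup>2 \<le> x \<bullet> (A *v x)" for x
    proof (cases "x = 0")
      case False
      then have "x0 \<bullet> (A *v x0) \<le> (x /\<^sub>R norm x) \<bullet> (A *v (x /\<^sub>R norm x))" by (intro x0(2)) simp
      then show ?thesis using False
        by (simp add: matrix_vector_mult_scaleR field_simps power2_eq_square)
    qed simp
  qed
qed

text \<open>
  The reciprocal of any value of the quadratic form on the unit sphere bounds the norm of the inverse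
  from below: apply the Cauchy-Schwarz inequality of the form to \<open>x\<close> and \<open>A\<^sup>-\<^sup>1x\<close>.
\<close>
lemma one_le_quadratic_form_times_op_norm_inverse:
  fixes A :: "real ^ 'n::finite ^ 'n"
  assumes A: "pos_definite A" and x: "norm x = 1"
  shows "1 \<le> (x \<bullet> (A *v x)) * op_norm (matrix_inv A)"
proof -
  define y where "y = matrix_inv A *v x"
  have Ay: "A *v y = x"
    by (simp add: y_def matrix_vector_mul_assoc matrix_inv_inverse(1) pos_definite_invertible[OF A])
  have semi: "pos_semidef A" by (rule pos_definite_imp_semidef[OF A])
  have "y \<bullet> x \<le> norm y * norm x" by (rule norm_cauchy_schwarz)
  also have "\<dots> \<le> op_norm (matrix_inv A) * norm x"
    using onorm[OF matrix_vector_mul_bounded_linear, of "matrix_inv A" x] x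
    by (simp add: op_norm_def y_def)
  finally have "y \<bullet> x \<le> op_norm (matrix_inv A)" using x by simp
  moreover have "0 \<le> x \<bullet> (A *v x)" using semi by (simp add: pos_semidef_def)
  ultimately have "(x \<bullet> (A *v x)) * (y \<bullet> x) \<le> (x \<bullet> (A *v x)) * op_norm (matrix_inv A)"
    by (rule mult_left_mono)
  moreover have "(x \<bullet> x)\<^sup>2 \<le> (x \<bullet> (A *v x)) * (y \<bullet> x)"
    using pos_semidef_cauchy_schwarz[OF semi, of x y] by (simp add: Ay)
  moreover have "x \<bullet> x = 1" using x by (simp add: dot_square_norm)
  ultimately show ?thesis by simp
qed

text \<open>
  The largest value of the Rayleigh quotient \<open>(x \<bullet> Hx) / (x \<bullet> Gx)\<close> together with a maximiser, which
  is an eigenvector of the pencil.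
\<close>
definition max_pencil_eigenvalue :: "real ^ 'n ^ 'n \<Rightarrow> real ^ 'n ^ 'n \<Rightarrow> real \<Rightarrow> real ^ 'n::finite \<Rightarrow> bool" where
  "max_pencil_eigenvalue G H lam x0 \<longleftrightarrow> x0 \<noteq> 0 \<and> 0 \<le> lam \<and> H *v x0 = lam *\<^sub>R (G *v x0) \<and>
     (\<forall>x. x \<bullet> (H *v x) \<le> lam * (x \<bullet> (G *v x)))"

text \<open>
  The quotient attains its maximum on the unit sphere. With the maximal value \<open>\<lambda>\<close>, the form of
  \<open>\<lambda>G - H\<close> is nonnegative and vanishes at the maximiser, so by the Cauchy-Schwarz inequality the
  maximiser lies in the kernel of \<open>\<lambda>G - H\<close>.
\<close>
lemma max_pencil_eigenvalue_exists:
  fixes G H :: "real ^ 'n::finite ^ 'n"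
  assumes G: "pos_definite G" and H: "pos_semidef H"
  obtains lam x0 where "max_pencil_eigenvalue G H lam x0"
proof -
  define R where "R x = (x \<bullet> (H *v x)) / (x \<bullet> (G *v x))" for x
  have Gpos: "0 < x \<bullet> (G *v x)" if "x \<noteq> 0" for x using G that by (simp add: pos_definite_def)
  have "\<exists>x0\<in>sphere (0::real^'n) 1. \<forall>x\<in>sphere 0 1. R x \<le> R x0"
  proof (rule continuous_attains_sup)
    have "x \<bullet> (G *v x) \<noteq> 0" if "x \<in> sphere 0 1" for x
      using that Gpos[of x] by force
    then show "continuous_on (sphere 0 1) R"
      unfolding R_def[abs_def]
      by (intro continuous_intros matrix_vector_mult_linear_continuous_on) auto
  qed auto
  then obtain x0 where x0: "norm x0 = 1" "\<And>x. norm x = 1 \<Longrightarrow> R x \<le> R x0" by auto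
  then have "x0 \<noteq> 0" by auto
  have R_scale: "R (c *\<^sub>R x) = R x" if "c \<noteq> 0" for c x
    using that by (simp add: R_def matrix_vector_mult_scaleR)
  have max: "x \<bullet> (H *v x) \<le> R x0 * (x \<bullet> (G *v x))" for x
  proof (cases "x = 0")
    case False
    then have "R x \<le> R x0" using x0(2)[of "x /\<^sub>R norm x"] R_scale[of "inverse (norm x)" x] by simp
    then show ?thesis using Gpos[OF False] by (simp add: R_def[of x] divide_le_eq)
  qed simp
  have "0 \<le> R x0" using H Gpos[OF \<open>x0 \<noteq> 0\<close>] by (simp add: R_def pos_semidef_def)
  define B where "B = R x0 *\<^sub>R G - H"
  have B_mult: "B *v x = R x0 *\<^sub>R (G *v x) - H *v x" for x
    by (simp add: B_def matrix_vector_mult_diff_rdistrib scaleR_matrix_vector_assoc)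
  have "pos_semidef B"
    unfolding pos_semidef_def
  proof (intro conjI allI)
    have "transpose G = G" "transpose H = H" using G H by (auto simp: pos_definite_def pos_semidef_def)
    then show "transpose B = B" by (simp add: B_def transpose_def vec_eq_iff)
    show "0 \<le> x \<bullet> (B *v x)" for x
      using max[of x] by (simp add: B_mult inner_diff_right)
  qed
  moreover have "x0 \<bullet> (B *v x0) = 0"
    using Gpos[OF \<open>x0 \<noteq> 0\<close>] by (simp add: B_mult inner_diff_right R_def)
  ultimately have "((B *v x0) \<bullet> (B *v x0))\<^sup>2 \<le> 0"
    using pos_semidef_cauchy_schwarz[of B "B *v x0" x0] by simp
  then have "B *v x0 = 0" by simp
  then have "H *v x0 = R x0 *\<^sub>R (G *v x0)" by (simp add: B_mult)
  then show ?thesis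
    using that \<open>x0 \<noteq> 0\<close> \<open>0 \<le> R x0\<close> max unfolding max_pencil_eigenvalue_def by blast
qed

lemma pencil_mult:
  assumes "pos_definite G"
  shows "G *v ((matrix_inv G ** H) *v x) = H *v x"
  by (simp add: matrix_vector_mul_assoc matrix_mul_assoc matrix_inv_inverse(1) pos_definite_invertible[OF assms])

lemma pencil_eigenvector:
  assumes "pos_definite G" "H *v x = lam *\<^sub>R (G *v x)"
  shows "(matrix_inv G ** H) *v x = lam *\<^sub>R x"
proof -
  have "(matrix_inv G ** H) *v x = matrix_inv G *v (lam *\<^sub>R (G *v x))"
    by (simp add: matrix_vector_mul_assoc[symmetric] assms(2))
  also have "\<dots> = lam *\<^sub>R ((matrix_inv G ** G) *v x)"
    by (simp add: matrix_vector_mul_assoc matrix_vector_mult_scaleR)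
  finally show ?thesis
    by (simp add: matrix_inv_inverse(2) pos_definite_invertible[OF assms(1)])
qed

text \<open>
  Real and imaginary parts of a complex eigenvector are handled separately, which avoids Hermitian
  forms.
\<close>
lemma complexified_matrix_vector:
  fixes A :: "real ^ 'n::finite ^ 'm::finite" and v :: "complex ^ 'n"
  shows "Re (((\<chi> i j. complex_of_real (A $ i $ j)) *v v) $ i) = (A *v (\<chi> j. Re (v $ j))) $ i"
    and "Im (((\<chi> i j. complex_of_real (A $ i $ j)) *v v) $ i) = (A *v (\<chi> j. Im (v $ j))) $ i"
  by (simp_all add: matrix_vector_mult_def)

text \<open>
  Let \<open>a + \<i>b\<close> be an eigenvector for \<open>r + \<i>s\<close> and \<open>N = a \<bullet> Ga + b \<bullet> Gb > 0\<close>. Symmetry of \<open>G\<close> and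
  \<open>H\<close> forces \<open>sN = 0\<close>, so the eigenvalue is real, and then \<open>rN = a \<bullet> Ha + b \<bullet> Hb\<close> lies
  between \<open>0\<close> and \<open>\<lambda>N\<close>.
\<close>
lemma spectral_radius_pencil:
  fixes G H :: "real ^ 'n::finite ^ 'n"
  assumes G: "pos_definite G" and H: "pos_semidef H" and max: "max_pencil_eigenvalue G H lam x0"
  shows "spectral_radius (matrix_inv G ** H) = lam"
proof -
  define A where "A = matrix_inv G ** H"
  define E where "E = {k. \<exists>v::complex^'n. v \<noteq> 0 \<and> (\<chi> i j. complex_of_real (A $ i $ j)) *v v = k *s v}"
  note lam = max[unfolded max_pencil_eigenvalue_def]
  have "complex_of_real lam \<in> E"
  proof -
    define v where "v = (\<chi> i. complex_of_real (x0 $ i))"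
    have re: "(\<chi> j. Re (v $ j)) = x0" and im: "(\<chi> j. Im (v $ j)) = 0"
      by (simp_all add: v_def vec_eq_iff)
    have "A *v x0 = lam *\<^sub>R x0" using pencil_eigenvector[OF G] lam unfolding A_def by blast
    then have "((\<chi> i j. complex_of_real (A $ i $ j)) *v v) $ i = (complex_of_real lam *s v) $ i" for i
      unfolding complex_eq_iff complexified_matrix_vector re im by (simp add: v_def)
    then have "(\<chi> i j. complex_of_real (A $ i $ j)) *v v = complex_of_real lam *s v"
      by (simp only: vec_eq_iff) simp
    moreover have "v \<noteq> 0" using lam re by (auto simp: vec_eq_iff v_def)
    ultimately show ?thesis unfolding E_def by blast
  qed
  moreover have "lam = cmod (complex_of_real lam)" using lam by simp
  ultimately have mem: "lam \<in> {cmod k | k. k \<in> E}" by blast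
  have le: "cmod k \<le> lam" if "k \<in> E" for k
  proof -
    obtain v where v: "v \<noteq> 0" and eig: "(\<chi> i j. complex_of_real (A $ i $ j)) *v v = k *s v"
      using \<open>k \<in> E\<close> unfolding E_def by blast
    define a b where "a = (\<chi> j. Re (v $ j))" and "b = (\<chi> j. Im (v $ j))"
    define r s where "r = Re k" and "s = Im k"
    have "(A *v a) $ i = (r *\<^sub>R a - s *\<^sub>R b) $ i" for i
      using complexified_matrix_vector(1)[of A v i] unfolding eig
      by (simp add: a_def b_def r_def s_def)
    then have "A *v a = r *\<^sub>R a - s *\<^sub>R b" by (simp only: vec_eq_iff) simp
    then have Ha: "H *v a = r *\<^sub>R (G *v a) - s *\<^sub>R (G *v b)"
      using pencil_mult[OF G, of H a]
      by (simp add: A_def[symmetric] matrix_vector_mult_diff_distrib matrix_vector_mult_scaleR)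
    have "(A *v b) $ i = (r *\<^sub>R b + s *\<^sub>R a) $ i" for i
      using complexified_matrix_vector(2)[of A v i] unfolding eig
      by (simp add: a_def b_def r_def s_def)
    then have "A *v b = r *\<^sub>R b + s *\<^sub>R a" by (simp only: vec_eq_iff) simp
    then have Hb: "H *v b = r *\<^sub>R (G *v b) + s *\<^sub>R (G *v a)"
      using pencil_mult[OF G, of H b]
      by (simp add: A_def[symmetric] matrix_vector_right_distrib matrix_vector_mult_scaleR)
    define N where "N = a \<bullet> (G *v a) + b \<bullet> (G *v b)"
    have "a \<noteq> 0 \<or> b \<noteq> 0" using v by (auto simp: a_def b_def vec_eq_iff complex_eq_iff)
    moreover have "0 \<le> x \<bullet> (G *v x)" "x \<noteq> 0 \<Longrightarrow> 0 < x \<bullet> (G *v x)" for x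
      using G pos_definite_imp_semidef[OF G] by (auto simp: pos_definite_def pos_semidef_def)
    ultimately have "0 < N"
      unfolding N_def by (metis add_nonneg_pos add_pos_nonneg)
    have symG: "a \<bullet> (G *v b) = b \<bullet> (G *v a)" and symH: "a \<bullet> (H *v b) = b \<bullet> (H *v a)"
      using G H symmetric_inner_commute unfolding pos_definite_def pos_semidef_def by blast+
    have "s * N = 0"
      using symH symG by (simp add: Ha Hb N_def inner_add_right inner_diff_right algebra_simps)
    then have "s = 0" using \<open>0 < N\<close> by simp
    have "r * N = a \<bullet> (H *v a) + b \<bullet> (H *v b)"
      using \<open>s = 0\<close> by (simp add: Ha Hb N_def algebra_simps)
    moreover have "0 \<le> a \<bullet> (H *v a) + b \<bullet> (H *v b)"
      using H by (simp add: pos_semidef_def)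
    moreover have "a \<bullet> (H *v a) + b \<bullet> (H *v b) \<le> lam * N"
      using lam by (simp add: N_def distrib_left add_mono)
    ultimately have "0 \<le> r * N" "r * N \<le> lam * N" by simp_all
    then have "0 \<le> r" "r \<le> lam" using \<open>0 < N\<close> by (simp_all add: zero_le_mult_iff)
    moreover have "k = complex_of_real r" using \<open>s = 0\<close> by (simp add: r_def s_def complex_eq_iff)
    ultimately show ?thesis by simp
  qed
  have "Sup {cmod k | k. k \<in> E} = lam"
    using mem le by (intro cSup_eq_maximum) auto
  then show ?thesis by (simp add: spectral_radius_def E_def A_def)
qed

text \<open>
  If \<open>\<lambda> < 1\<close>, the iteration contracts by the factor \<open>\<lambda>\<close> in the norm of \<open>G\<close>, and this norm dominates
  a multiple of the Euclidean one. Conversely, on the eigenvector the series is a geometric series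
  with ratio \<open>\<lambda> \<ge> 0\<close>.
\<close>
lemma neumann_converges_pencil:
  fixes G H :: "real ^ 'n::finite ^ 'n"
  assumes G: "pos_definite G" and H: "pos_semidef H" and max: "max_pencil_eigenvalue G H lam x0"
  shows "neumann_converges (matrix_inv G ** H) \<longleftrightarrow> lam < 1"
proof -
  define A where "A = matrix_inv G ** H"
  define P where "P k x = ((\<lambda>y. A *v y) ^^ k) x" for k and x :: "real ^ 'n"
  note lam = max[unfolded max_pencil_eigenvalue_def]
  have necessary: "lam < 1" if "summable (\<lambda>k. P k x0)"
  proof -
    have Ax0: "A *v x0 = lam *\<^sub>R x0" using pencil_eigenvector[OF G] lam unfolding A_def by blast
    have "P k x0 = lam ^ k *\<^sub>R x0" for k
      unfolding P_def by (induction k) (simp_all add: matrix_vector_mult_scaleR Ax0)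
    then have "(\<lambda>k. norm (lam ^ k *\<^sub>R x0)) \<longlonglongrightarrow> 0"
      using summable_LIMSEQ_zero[OF that] by (intro tendsto_norm_zero) simp
    then have "(\<lambda>k. lam ^ k * norm x0) \<longlonglongrightarrow> 0" using lam by simp
    then have "(\<lambda>k. lam ^ k * norm x0 / norm x0) \<longlonglongrightarrow> 0 / norm x0"
      using lam by (intro tendsto_divide tendsto_const) auto
    then have "(\<lambda>k. lam ^ k) \<longlonglongrightarrow> 0" using lam by simp
    then show "lam < 1" using lam LIMSEQ_abs_realpow_zero2[of lam]
      by (metis LIMSEQ_le_const linorder_not_less not_one_le_zero one_le_power)
  qed
  have sufficient: "summable (\<lambda>k. P k x)" if "lam < 1" for x
  proof -
    obtain m where m: "0 < m" "\<And>x. m * (norm x)\<^sup>2 \<le> x \<bullet> (G *v x)"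
      using pos_definite_lower_bound[OF G] by blast
    have Gnn: "0 \<le> x \<bullet> (G *v x)" for x
      using pos_definite_imp_semidef[OF G] by (simp add: pos_semidef_def)
    \<comment> \<open>With \<open>y = Ax\<close> one has \<open>Gy = Hx\<close>, and the Cauchy-Schwarz inequality of \<open>H\<close> bounds \<open>y \<bullet> Gy\<close> by itself.\<close>
    have contract: "(A *v x) \<bullet> (G *v (A *v x)) \<le> lam\<^sup>2 * (x \<bullet> (G *v x))" for x
    proof -
      define y where "y = A *v x"
      have Gy: "G *v y = H *v x" unfolding y_def A_def by (rule pencil_mult[OF G])
      have "(y \<bullet> (G *v y))\<^sup>2 \<le> (y \<bullet> (H *v y)) * (x \<bullet> (H *v x))"
        unfolding Gy by (rule pos_semidef_cauchy_schwarz[OF H])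
      also have "\<dots> \<le> (lam * (y \<bullet> (G *v y))) * (lam * (x \<bullet> (G *v x)))"
        using lam H Gnn by (intro mult_mono) (auto simp: pos_semidef_def)
      finally have "(y \<bullet> (G *v y)) * (y \<bullet> (G *v y)) \<le> (lam\<^sup>2 * (x \<bullet> (G *v x))) * (y \<bullet> (G *v y))"
        by (simp add: power2_eq_square mult_ac)
      then show ?thesis
        using Gnn[of y] Gnn[of x] unfolding y_def[symmetric]
        by (cases "y \<bullet> (G *v y) = 0") (auto simp: less_le)
    qed
    have "P k x \<bullet> (G *v P k x) \<le> (lam ^ k)\<^sup>2 * (x \<bullet> (G *v x))" for k
    proof (induction k)
      case (Suc k)
      have "P (Suc k) x = A *v P k x" by (simp add: P_def)
      then have "P (Suc k) x \<bullet> (G *v P (Suc k) x) \<le> lam\<^sup>2 * (P k x \<bullet> (G *v P k x))"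
        using contract by simp
      also have "\<dots> \<le> lam\<^sup>2 * ((lam ^ k)\<^sup>2 * (x \<bullet> (G *v x)))"
        using Suc by (intro mult_left_mono) auto
      finally show ?case by (simp add: power2_eq_square mult_ac)
    qed (simp add: P_def)
    then have "m * (norm (P k x))\<^sup>2 \<le> (lam ^ k)\<^sup>2 * (x \<bullet> (G *v x))" for k
      using m(2) order_trans by blast
    then have "(norm (P k x))\<^sup>2 \<le> (lam ^ k)\<^sup>2 * (x \<bullet> (G *v x)) / m" for k
      using m(1) by (simp add: pos_le_divide_eq mult.commute)
    moreover have "(lam ^ k * sqrt (x \<bullet> (G *v x) / m))\<^sup>2 = (lam ^ k)\<^sup>2 * (x \<bullet> (G *v x)) / m" for k
      unfolding power_mult_distrib using m(1) Gnn[of x] by simp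
    ultimately have "(norm (P k x))\<^sup>2 \<le> (lam ^ k * sqrt (x \<bullet> (G *v x) / m))\<^sup>2" for k
      by simp
    moreover have "0 \<le> lam ^ k * sqrt (x \<bullet> (G *v x) / m)" for k
      using lam Gnn[of x] m(1) by simp
    ultimately have "norm (P k x) \<le> lam ^ k * sqrt (x \<bullet> (G *v x) / m)" for k
      by (rule power2_le_imp_le)
    then have "norm (P k x) \<le> sqrt (x \<bullet> (G *v x) / m) * lam ^ k" for k
      by (simp only: mult.commute)
    moreover have "summable (\<lambda>k. sqrt (x \<bullet> (G *v x) / m) * lam ^ k)"
      using lam that by (intro summable_mult summable_geometric) auto
    ultimately show ?thesis by (blast intro: summable_comparison_test')
  qed
  have "neumann_converges A \<longleftrightarrow> (\<forall>x. summable (\<lambda>k. P k x))"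
    by (simp add: neumann_converges_def P_def)
  then show ?thesis using necessary sufficient unfolding A_def by auto
qed

lemma pencil_difference_pos_definite:
  fixes G H :: "real ^ 'n::finite ^ 'n"
  assumes G: "pos_definite G" and H: "pos_semidef H" and max: "max_pencil_eigenvalue G H lam x0"
    and "lam < 1"
  shows "pos_definite (G - H)"
  unfolding pos_definite_def
proof (intro conjI allI impI)
  have "transpose G = G" "transpose H = H" using G H by (auto simp: pos_definite_def pos_semidef_def)
  then show "transpose (G - H) = G - H" by (simp add: transpose_def vec_eq_iff)
  fix x :: "real ^ 'n" assume "x \<noteq> 0"
  then have pos: "0 < x \<bullet> (G *v x)" using G by (simp add: pos_definite_def)
  have "x \<bullet> (H *v x) \<le> lam * (x \<bullet> (G *v x))" using max by (simp add: max_pencil_eigenvalue_def)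
  also have "\<dots> < x \<bullet> (G *v x)" using pos \<open>lam < 1\<close> by simp
  finally show "0 < x \<bullet> ((G - H) *v x)" by (simp add: matrix_vector_mult_diff_rdistrib inner_diff_right)
qed

lemma invertible_pencil_difference:
  fixes G H :: "real ^ 'n::finite ^ 'n"
  assumes G: "pos_definite G" and H: "pos_semidef H" and max: "max_pencil_eigenvalue G H lam x0"
    and "lam \<le> 1"
  shows "invertible (G - H) \<longleftrightarrow> lam < 1"
proof
  assume inv: "invertible (G - H)"
  have "lam \<noteq> 1"
  proof
    assume "lam = 1"
    then have "(G - H) *v x0 = 0"
      using max by (simp add: max_pencil_eigenvalue_def matrix_vector_mult_diff_rdistrib)
    then have "x0 = 0"
      using inv unfolding invertible_left_inverse matrix_left_invertible_ker by blast
    then show False using max by (simp add: max_pencil_eigenvalue_def)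
  qed
  then show "lam < 1" using \<open>lam \<le> 1\<close> by simp
qed (use pencil_difference_pos_definite[OF G H max] pos_definite_invertible in blast)

section \<open>Derivatives of locally Lipschitz maps\<close>
lemma has_derivative_iff_eventually_nhds:
  fixes f :: "'a::real_normed_vector \<Rightarrow> 'b::real_normed_vector"
  shows "(f has_derivative D) (at x) \<longleftrightarrow> bounded_linear D \<and>
    (\<forall>e>0. \<forall>\<^sub>F y in nhds x. norm (f y - f x - D (y - x)) \<le> e * norm (y - x))"
  by (simp add: has_derivative_at_alt eventually_nhds_metric dist_norm)

lemma onorm_derivative_le_local_lipschitz:
  fixes f :: "'a::real_normed_vector \<Rightarrow> 'b::real_normed_vector"
  assumes D: "(f has_derivative D) (at x)"
    and lip: "\<forall>\<^sub>F y in nhds x. norm (f y - f x) \<le> C * norm (y - x)" and "0 \<le> C"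
  shows "onorm D \<le> C"
proof (rule field_le_epsilon)
  fix e :: real assume "0 < e"
  interpret D: bounded_linear D using D by (rule has_derivative_bounded_linear)
  have "\<forall>\<^sub>F y in nhds x. norm (f y - f x - D (y - x)) \<le> e * norm (y - x)"
    using D \<open>0 < e\<close> by (simp add: has_derivative_iff_eventually_nhds)
  with lip have "\<forall>\<^sub>F y in nhds x. norm (D (y - x)) \<le> (C + e) * norm (y - x)"
  proof eventually_elim
    case (elim y)
    then show ?case
      using norm_triangle_ineq4[of "f y - f x" "f y - f x - D (y - x)"] by (simp add: distrib_right)
  qed
  then obtain d where d: "0 < d" "\<And>y. dist y x < d \<Longrightarrow> norm (D (y - x)) \<le> (C + e) * norm (y - x)"
    unfolding eventually_nhds_metric by blast
  show "onorm D \<le> C + e"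
  proof (rule onorm_bound)
    show "0 \<le> C + e" using \<open>0 \<le> C\<close> \<open>0 < e\<close> by simp
    show "norm (D h) \<le> (C + e) * norm h" for h
    proof (cases "h = 0")
      case False
      define s where "s = d / (2 * norm h)"
      have "0 < s" using False d(1) by (simp add: s_def)
      have "s * norm h < d" using False d(1) by (simp add: s_def)
      then have "norm (D (s *\<^sub>R h)) \<le> (C + e) * norm (s *\<^sub>R h)"
        using d(2)[of "x + s *\<^sub>R h"] \<open>0 < s\<close> by (simp add: dist_norm)
      then show ?thesis using \<open>0 < s\<close> by (simp add: D.scaleR)
    qed (simp add: D.zero)
  qed
qed

section \<open>Hessians of mobilisation costs and congestion\<close>

lemma diag_mat_mult: "(diag_mat d *v x) $ i = d $ i * x $ i"
proof -
  have "(diag_mat d *v x) $ i = (\<Sum>j\<in>UNIV. if i = j then d $ i * x $ j else 0)"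
    unfolding diag_mat_def matrix_vector_mult_def
    by (auto simp del: sum.delta sum.delta' intro!: sum.cong)
  then show ?thesis by simp
qed

lemma transpose_diag_mat: "transpose (diag_mat d) = diag_mat d"
  by (simp add: transpose_def diag_mat_def vec_eq_iff)

lemma cost_hessian_pos_definite:
  assumes "\<And>i. 0 < c'' i (u $ i)"
  shows "pos_definite (cost_hessian c'' u)"
  unfolding pos_definite_def cost_hessian_def
proof (intro conjI allI impI transpose_diag_mat)
  fix x :: "real ^ 'a" assume "x \<noteq> 0"
  then obtain i where "x $ i \<noteq> 0" by (auto simp: vec_eq_iff)
  have "0 < (\<Sum>i\<in>UNIV. c'' i (u $ i) * (x $ i)\<^sup>2)"
    using assms \<open>x $ i \<noteq> 0\<close> by (intro sum_pos2[of _ i]) (auto simp: less_imp_le)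
  also have "\<dots> = x \<bullet> (diag_mat (\<chi> i. c'' i (u $ i)) *v x)"
    by (simp add: inner_vec_def diag_mat_mult power2_eq_square mult_ac)
  finally show "0 < x \<bullet> (diag_mat (\<chi> i. c'' i (u $ i)) *v x)" .
qed

lemma congestion_hessian_mult:
  "congestion_hessian M q *v h = transpose (routing M) *v
    (\<chi> l. penalty M $ l * of_bool (capacity M $ l < q $ l) * load M h $ l)"
proof -
  have "congestion_hessian M q *v h = transpose (routing M) *v
      (diag_mat (\<chi> l. penalty M $ l * of_bool (capacity M $ l < q $ l)) *v load M h)"
    by (simp only: congestion_hessian_def load_def matrix_vector_mul_assoc matrix_mul_assoc)
  moreover have "diag_mat d *v x = (\<chi> l. d $ l * x $ l)" for d x :: "real ^ 'b"
    by (simp add: vec_eq_iff diag_mat_mult)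
  ultimately show ?thesis by simp
qed

lemma congestion_hessian_pos_semidef:
  assumes "\<And>l. 0 \<le> penalty M $ l"
  shows "pos_semidef (congestion_hessian M q)"
  unfolding pos_semidef_def
proof (intro conjI allI)
  show "transpose (congestion_hessian M q) = congestion_hessian M q"
    unfolding congestion_hessian_def matrix_transpose_mul transpose_diag_mat transpose_transpose
    by (simp only: matrix_mul_assoc)
  fix x
  have "x \<bullet> (congestion_hessian M q *v x)
      = load M x \<bullet> (\<chi> l. penalty M $ l * of_bool (capacity M $ l < q $ l) * load M x $ l)"
    unfolding congestion_hessian_mult load_def transpose_matrix_vector
    by (simp only: inner_commute[of x] dot_lmul_matrix) (simp only: inner_commute)
  also have "\<dots> = (\<Sum>l\<in>UNIV. penalty M $ l * of_bool (capacity M $ l < q $ l) * (load M x $ l)\<^sup>2)"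
    unfolding inner_vec_def by (intro sum.cong refl) (simp add: power2_eq_square)
  also have "0 \<le> \<dots>" using assms by (intro sum_nonneg) simp
  finally show "0 \<le> x \<bullet> (congestion_hessian M q *v x)" .
qed

section \<open>Equilibria, stationarity and minimisers\<close>
lemma single_rate_deviation: "(\<chi> j. if j = i then v else u $ j) = u + axis i (v - u $ i)"
  for u :: "real ^ 'z::finite"
  by (simp add: vec_eq_iff axis_def)

text \<open>
  The activation and exposure terms, the drift of the other backlogs and the belief generator cancel;
  only the own component of the gradient of the value function survives.
\<close>
lemma zone_hamiltonian_deviation:
  "zone_hamiltonian M a b i t w q g (\<chi> j. if j = i then v else u $ j) - zone_hamiltonian M a b i t w q g u
    = (mob_cost M i v - mob_cost M i (u $ i)) - (g $ i - congestion_price M q i) * (v - u $ i)"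
proof -
  have "g \<bullet> backlog_drift (\<chi> j. if j = i then v else u $ j) = g \<bullet> backlog_drift u - g $ i * (v - u $ i)"
    by (simp add: single_rate_deviation backlog_drift_def inner_diff_right inner_axis)
  then show ?thesis
    by (cases w) (simp add: zone_hamiltonian_def running_cost_def algebra_simps)
qed

context evacuation_game
begin

text \<open>
  The bounds of the box supply the deviations that detect the sign of the gradient: \<open>v = 0\<close> shows
  \<open>g \<le> 0\<close> if \<open>u\<^sub>i > 0\<close>, and the maximal rate shows \<open>g \<ge> 0\<close> if \<open>u\<^sub>i\<close> is below it.
\<close>
lemma wardrop_stationary_iff_componentwise:
  "wardrop_stationary M c' p u \<longleftrightarrow> u \<in> rate_box M \<and>
    (\<forall>i. \<forall>v\<in>{0..max_rate M $ i}. 0 \<le> beckmann_gradient M c' p u $ i * (v - u $ i))"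
proof -
  have "((u $ i < max_rate M $ i \<longrightarrow> 0 \<le> g) \<and> (0 < u $ i \<longrightarrow> g \<le> 0)) \<longleftrightarrow>
      (\<forall>v\<in>{0..max_rate M $ i}. 0 \<le> g * (v - u $ i))" if "u \<in> rate_box M" for i and g :: real
  proof
    assume *: "(u $ i < max_rate M $ i \<longrightarrow> 0 \<le> g) \<and> (0 < u $ i \<longrightarrow> g \<le> 0)"
    show "\<forall>v\<in>{0..max_rate M $ i}. 0 \<le> g * (v - u $ i)"
    proof
      fix v assume v: "v \<in> {0..max_rate M $ i}"
      consider "v = u $ i" | "u $ i < v" "0 \<le> g" | "v < u $ i" "g \<le> 0"
        using * v by (cases v "u $ i" rule: linorder_cases) auto
      then show "0 \<le> g * (v - u $ i)"
        by cases (auto intro: mult_nonneg_nonneg mult_nonpos_nonpos)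
    qed
  next
    assume *: "\<forall>v\<in>{0..max_rate M $ i}. 0 \<le> g * (v - u $ i)"
    have "0 \<le> g * (max_rate M $ i - u $ i)" "0 \<le> g * (0 - u $ i)"
      using * max_rate_nonneg[of i] by (auto simp del: diff_0)
    then show "(u $ i < max_rate M $ i \<longrightarrow> 0 \<le> g) \<and> (0 < u $ i \<longrightarrow> g \<le> 0)"
      by (auto simp: zero_le_mult_iff mult_le_0_iff)
  qed
  moreover have "p $ i \<le> c' i (u $ i) + congestion_price M (load M u) i
        \<longleftrightarrow> 0 \<le> beckmann_gradient M c' p u $ i"
    and "c' i (u $ i) + congestion_price M (load M u) i \<le> p $ i
        \<longleftrightarrow> beckmann_gradient M c' p u $ i \<le> 0" for i
    by (simp_all add: beckmann_gradient_def)
  ultimately show ?thesis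
    unfolding wardrop_stationary_def by (simp cong: conj_cong)
qed

lemma wardrop_stationary_iff_variational_inequality:
  "wardrop_stationary M c' p u \<longleftrightarrow>
    u \<in> rate_box M \<and> (\<forall>v\<in>rate_box M. 0 \<le> beckmann_gradient M c' p u \<bullet> (v - u))"
proof -
  have "0 \<le> beckmann_gradient M c' p u $ i * (x - u $ i)"
    if u: "u \<in> rate_box M" and vi: "\<forall>v\<in>rate_box M. 0 \<le> beckmann_gradient M c' p u \<bullet> (v - u)"
      and x: "x \<in> {0..max_rate M $ i}" for i x
  proof -
    have "(\<chi> j. if j = i then x else u $ j) \<in> rate_box M" using u x by (simp add: rate_box_def)
    then have "0 \<le> beckmann_gradient M c' p u \<bullet> ((\<chi> j. if j = i then x else u $ j) - u)"
      using vi by blast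
    then show ?thesis unfolding single_rate_deviation by (simp add: inner_axis)
  qed
  moreover have "0 \<le> beckmann_gradient M c' p u \<bullet> (v - u)"
    if "\<forall>i. \<forall>v\<in>{0..max_rate M $ i}. 0 \<le> beckmann_gradient M c' p u $ i * (v - u $ i)"
      and "v \<in> rate_box M" for v
    unfolding inner_vec_def using that rate_boxD by (auto intro!: sum_nonneg)
  ultimately show ?thesis unfolding wardrop_stationary_iff_componentwise by blast
qed

lemma is_arg_min_iff_wardrop_stationary:
  "is_arg_min (beckmann_objective M p) (\<lambda>v. v \<in> rate_box M) u \<longleftrightarrow> wardrop_stationary M c' p u"
proof
  assume "is_arg_min (beckmann_objective M p) (\<lambda>v. v \<in> rate_box M) u"
  then have u: "u \<in> rate_box M"
    and min: "\<And>v. v \<in> rate_box M \<Longrightarrow> beckmann_objective M p u \<le> beckmann_objective M p v"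
    by (auto simp: is_arg_min_linorder)
  have dual: "0 \<le> beckmann_gradient M c' p v \<bullet> (v - u)" if v: "v \<in> rate_box M" for v
    using beckmann_objective_above_tangent(2)[OF v u, of p] min[OF v]
    unfolding inner_diff_right by linarith
  show "wardrop_stationary M c' p u"
    unfolding wardrop_stationary_iff_variational_inequality
    using u minty_variational_inequality[OF convex_rate_box beckmann_gradient_continuous u dual] by blast
next
  assume "wardrop_stationary M c' p u"
  then have u: "u \<in> rate_box M"
    and vi: "\<And>v. v \<in> rate_box M \<Longrightarrow> 0 \<le> beckmann_gradient M c' p u \<bullet> (v - u)"
    by (auto simp: wardrop_stationary_iff_variational_inequality)
  have "beckmann_objective M p u \<le> beckmann_objective M p v" if v: "v \<in> rate_box M" for v
    using beckmann_objective_above_tangent(2)[OF u v, of p] vi[OF v] by linarith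
  then show "is_arg_min (beckmann_objective M p) (\<lambda>v. v \<in> rate_box M) u"
    using u by (simp add: is_arg_min_linorder)
qed

text \<open>
  The tangent inequality at both endpoints bounds increments of the objective by the gradient, which
  is bounded on the compact box.
\<close>
lemma beckmann_objective_continuous: "continuous_on (rate_box M) (beckmann_objective M p)"
proof -
  have "bounded (beckmann_gradient M c' p ` rate_box M)"
    by (intro compact_imp_bounded compact_continuous_image beckmann_gradient_continuous compact_rate_box)
  then obtain B where B: "0 < B" "\<And>u. u \<in> rate_box M \<Longrightarrow> norm (beckmann_gradient M c' p u) \<le> B"
    unfolding bounded_pos by auto
  have one_sided: "beckmann_objective M p u - beckmann_objective M p v \<le> B * dist u v"
    if u: "u \<in> rate_box M" and v: "v \<in> rate_box M" for u v
  proof -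
    have "beckmann_objective M p u - beckmann_objective M p v \<le> - (beckmann_gradient M c' p u \<bullet> (v - u))"
      using beckmann_objective_above_tangent(2)[OF u v, of p] by simp
    also have "\<dots> \<le> norm (beckmann_gradient M c' p u) * norm (v - u)"
      using Cauchy_Schwarz_ineq2[of "beckmann_gradient M c' p u" "v - u"] by linarith
    also have "\<dots> \<le> B * norm (v - u)" using B(2)[OF u] by (intro mult_right_mono) auto
    finally show ?thesis by (simp add: dist_norm norm_minus_commute)
  qed
  have "B-lipschitz_on (rate_box M) (beckmann_objective M p)"
  proof (rule lipschitz_onI)
    fix u v assume "u \<in> rate_box M" "v \<in> rate_box M"
    then show "dist (beckmann_objective M p u) (beckmann_objective M p v) \<le> B * dist u v"
      using one_sided[of u v] one_sided[of v u]
      by (simp add: dist_real_def abs_le_iff dist_commute[of v u])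
  qed (use B(1) in simp)
  then show ?thesis by (rule lipschitz_on_continuous_on)
qed

lemma wardrop_stationary_ex1: "\<exists>!u. wardrop_stationary M c' p u"
proof -
  have "(0 :: real ^ 'z) \<in> rate_box M" by (simp add: rate_box_def max_rate_nonneg)
  then have "rate_box M \<noteq> {}" by blast
  from continuous_attains_inf[OF compact_rate_box this beckmann_objective_continuous]
  obtain u where "is_arg_min (beckmann_objective M p) (\<lambda>v. v \<in> rate_box M) u"
    unfolding is_arg_min_linorder by blast
  moreover have "u = v" if "wardrop_stationary M c' p u" "wardrop_stationary M c' p v" for u v
  proof (rule ccontr)
    assume "u \<noteq> v"
    have box: "u \<in> rate_box M" "v \<in> rate_box M"
      using that by (simp_all add: wardrop_stationary_def)
    moreover have "0 \<le> beckmann_gradient M c' p u \<bullet> (v - u)"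
      using that(1) box(2) by (simp add: wardrop_stationary_iff_variational_inequality)
    moreover have "beckmann_objective M p v \<le> beckmann_objective M p u"
      using that(2) box(1) by (simp add: is_arg_min_iff_wardrop_stationary[symmetric] is_arg_min_linorder)
    ultimately show False using beckmann_objective_above_tangent(1)[of u v p] \<open>u \<noteq> v\<close> by simp
  qed
  ultimately show ?thesis unfolding is_arg_min_iff_wardrop_stationary by blast
qed

definition equilibrium :: "real ^ 'z \<Rightarrow> real ^ 'z" where
  "equilibrium p = (THE u. wardrop_stationary M c' p u)"

lemma wardrop_stationary_iff_equilibrium: "wardrop_stationary M c' p u \<longleftrightarrow> u = equilibrium p"
  unfolding equilibrium_def using theI'[OF wardrop_stationary_ex1] wardrop_stationary_ex1 by blast

lemma equilibrium_stationary: "wardrop_stationary M c' p (equilibrium p)"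
  by (simp add: wardrop_stationary_iff_equilibrium)

lemma equilibrium_in_rate_box: "equilibrium p \<in> rate_box M"
  using equilibrium_stationary by (simp add: wardrop_stationary_def)

text \<open>
  A zone that takes its net price \<open>y\<close> as given minimises a convex function of its own rate. This is the
  same argument as for the Beckmann objective, in dimension one.
\<close>
lemma private_optimum_iff_marginal:
  assumes x: "x \<in> {0..max_rate M $ i}"
  shows "(\<forall>v\<in>{0..max_rate M $ i}. 0 \<le> (mob_cost M i v - mob_cost M i x) - y * (v - x)) \<longleftrightarrow>
    (\<forall>v\<in>{0..max_rate M $ i}. 0 \<le> (c' i x - y) * (v - x))"
proof
  assume opt: "\<forall>v\<in>{0..max_rate M $ i}. 0 \<le> (mob_cost M i v - mob_cost M i x) - y * (v - x)"
  have "0 \<le> (c' i v - y) \<bullet> (v - x)" if v: "v \<in> {0..max_rate M $ i}" for v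
  proof -
    have "0 \<le> (mob_cost M i v - mob_cost M i x) - y * (v - x)" using opt v by blast
    then show ?thesis using cost_above_tangent(2)[OF v x] by (simp add: algebra_simps)
  qed
  moreover have "continuous_on {0..max_rate M $ i} (\<lambda>v. c' i v - y)"
    by (intro continuous_intros cost_C1)
  ultimately have "0 \<le> (c' i x - y) \<bullet> (v - x)" if "v \<in> {0..max_rate M $ i}" for v
    using minty_variational_inequality[of "{0..max_rate M $ i}" "\<lambda>v. c' i v - y" x v] x that
    by blast
  then show "\<forall>v\<in>{0..max_rate M $ i}. 0 \<le> (c' i x - y) * (v - x)"
    by simp
next
  assume marginal: "\<forall>v\<in>{0..max_rate M $ i}. 0 \<le> (c' i x - y) * (v - x)"
  show "\<forall>v\<in>{0..max_rate M $ i}. 0 \<le> (mob_cost M i v - mob_cost M i x) - y * (v - x)"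
  proof
    fix v assume v: "v \<in> {0..max_rate M $ i}"
    then have "0 \<le> (c' i x - y) * (v - x)" using marginal by blast
    then show "0 \<le> (mob_cost M i v - mob_cost M i x) - y * (v - x)"
      using cost_above_tangent(2)[OF x v] by (simp add: left_diff_distrib)
  qed
qed

lemma wardrop_equilibrium_iff_stationary:
  "wardrop_equilibrium M a b t w G u \<longleftrightarrow> wardrop_stationary M c' (\<chi> i. G i $ i) u"
proof -
  have each_zone: "(\<forall>v\<in>{0..max_rate M $ i}. zone_hamiltonian M a (b i) i t w (load M u) (G i) u
        \<le> zone_hamiltonian M a (b i) i t w (load M u) (G i) (\<chi> j. if j = i then v else u $ j)) \<longleftrightarrow>
      (\<forall>v\<in>{0..max_rate M $ i}. 0 \<le> beckmann_gradient M c' (\<chi> i. G i $ i) u $ i * (v - u $ i))"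
    if "u \<in> rate_box M" for i
  proof -
    have "c' i (u $ i) - (G i $ i - congestion_price M (load M u) i)
        = beckmann_gradient M c' (\<chi> i. G i $ i) u $ i"
      by (simp add: beckmann_gradient_def)
    then show ?thesis
      using private_optimum_iff_marginal[OF rate_boxD[OF that],
          of i "G i $ i - congestion_price M (load M u) i"]
      unfolding zone_hamiltonian_deviation[of M a "b i" i t w "load M u" "G i" _ u, symmetric]
        diff_ge_0_iff_ge by simp
  qed
  show ?thesis
    unfolding wardrop_equilibrium_def wardrop_stationary_iff_componentwise
    by (rule conj_cong[OF refl], rule all_cong1, rule each_zone)
qed

text \<open>
  A net price outside the range of the marginal cost contradicts complementarity everywhere except
  on one face. Inside that range both inequalities hold with equality, also on the faces, and
  injectivity of the marginal cost recovers the rate.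
\<close>
lemma wardrop_stationary_saturated_feedback:
  assumes "wardrop_stationary M c' p u"
  shows "u $ i = box_proj (max_rate M $ i) (marginal_inverse (c' i) (max_rate M $ i)
    (p $ i - congestion_price M (load M u) i))"
proof -
  define b y x where "b = max_rate M $ i" and "y = p $ i - congestion_price M (load M u) i" and "x = u $ i"
  have x: "x \<in> {0..b}" and lower: "x < b \<Longrightarrow> y \<le> c' i x" and upper: "0 < x \<Longrightarrow> c' i x \<le> y"
    using assms by (auto simp: wardrop_stationary_def rate_box_def b_def x_def y_def algebra_simps)
  have strict: "strict_mono_on {0..b} (c' i)" unfolding b_def by (rule marginal_cost_strict_mono)
  have mono: "c' i v \<le> c' i w" if "v \<in> {0..b}" "w \<in> {0..b}" "v \<le> w" for v w
    using strict_mono_on_leD[OF strict that] .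
  consider "y < c' i 0" | "c' i b < y" "c' i 0 \<le> y" | "c' i 0 \<le> y" "y \<le> c' i b" by linarith
  then have "x = box_proj b (marginal_inverse (c' i) b y)"
  proof cases
    case 1
    then have "x = 0" using upper mono[of 0 x] x by force
    then show ?thesis using 1 x by (simp add: marginal_inverse_def box_proj_def)
  next
    case 2
    then have "x = b" using lower mono[of x b] x by force
    then show ?thesis using 2 x by (simp add: marginal_inverse_def box_proj_def max_def)
  next
    case 3
    have "y \<le> c' i x" using lower 3 x by (cases "x < b") auto
    moreover have "c' i x \<le> y" using upper 3 x by (cases "0 < x") auto
    ultimately have "c' i x = y" by simp
    then have "the_inv_into {0..b} (c' i) y = x"
      using the_inv_into_f_f[OF strict_mono_on_imp_inj_on[OF strict] x] by simp
    then show ?thesis using 3 x by (simp add: marginal_inverse_def box_proj_def min_def max_def)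
  qed
  then show ?thesis by (simp add: b_def x_def y_def)
qed

text \<open>
  Test the variational inequality of each rate vector with the other one and add. The congestion
  terms, \<open>\<Sum>\<^sub>l (g\<^sub>l(q\<^sub>l) - g\<^sub>l(q'\<^sub>l)) (q\<^sub>l - q'\<^sub>l)\<close>, are nonnegative and may be dropped.
\<close>
lemma wardrop_stationary_monotone:
  assumes u: "wardrop_stationary M c' p u" and v: "wardrop_stationary M c' p' v"
  shows "(\<Sum>i\<in>UNIV. (c' i (u $ i) - c' i (v $ i)) * (u $ i - v $ i)) \<le> (p - p') \<bullet> (u - v)"
proof -
  have "0 \<le> beckmann_gradient M c' p u \<bullet> (v - u)" "0 \<le> beckmann_gradient M c' p' v \<bullet> (u - v)"
    using u v unfolding wardrop_stationary_iff_variational_inequality by auto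
  then have "beckmann_gradient M c' p u \<bullet> (u - v) - beckmann_gradient M c' p' v \<bullet> (u - v) \<le> 0"
    by (simp add: inner_diff_right)
  also have "beckmann_gradient M c' p u \<bullet> (u - v) - beckmann_gradient M c' p' v \<bullet> (u - v) =
     (\<Sum>i\<in>UNIV. (c' i (u $ i) - c' i (v $ i)) * (u $ i - v $ i)) - (p - p') \<bullet> (u - v)
     + (\<Sum>l\<in>UNIV. (exposure M l (load M u $ l) - exposure M l (load M v $ l)) * load M (u - v) $ l)"
    unfolding beckmann_gradient_inner unfolding inner_vec_def
    by (simp add: sum_subtractf[symmetric] sum.distrib[symmetric] algebra_simps)
  finally have "(\<Sum>i\<in>UNIV. (c' i (u $ i) - c' i (v $ i)) * (u $ i - v $ i)) - (p - p') \<bullet> (u - v)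
     + (\<Sum>l\<in>UNIV. (exposure M l (load M u $ l) - exposure M l (load M v $ l)) * load M (u - v) $ l) \<le> 0" .
  moreover have "0 \<le> (\<Sum>l\<in>UNIV. (exposure M l (load M u $ l) - exposure M l (load M v $ l)) * load M (u - v) $ l)"
  proof (intro sum_nonneg)
    fix l
    have "(exposure M l a - exposure M l b) * (a - b) \<ge> 0" for a b
    proof (cases "a \<le> b")
      case True
      then have "exposure M l a \<le> exposure M l b"
        by (rule monoD[OF exposure_mono[OF penalty_nonneg]])
      then show ?thesis using True by (simp add: mult_nonpos_nonpos)
    next
      case False
      then have "exposure M l b \<le> exposure M l a"
        by (intro monoD[OF exposure_mono[OF penalty_nonneg]]) simp
      then show ?thesis using False by simp
    qed
    then show "0 \<le> (exposure M l (load M u $ l) - exposure M l (load M v $ l)) * load M (u - v) $ l"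
      by (simp add: load_diff[symmetric])
  qed
  ultimately show ?thesis by linarith
qed

text \<open>
  The growth of the marginal costs is required only at the two equilibria that are compared, so the
  bound serves both the global Lipschitz estimate and the local one at a fixed price.
\<close>
lemma equilibrium_distance_bound:
  assumes growth: "\<And>i. m * (equilibrium p $ i - equilibrium p' $ i)\<^sup>2 \<le>
      (c' i (equilibrium p $ i) - c' i (equilibrium p' $ i)) * (equilibrium p $ i - equilibrium p' $ i)"
  shows "m * norm (equilibrium p - equilibrium p') \<le> norm (p - p')"
proof -
  define h where "h = equilibrium p - equilibrium p'"
  have "m * (norm h)\<^sup>2 = (\<Sum>i\<in>UNIV. m * (h $ i)\<^sup>2)"
    unfolding power2_norm_eq_inner inner_vec_def by (simp add: sum_distrib_left power2_eq_square)
  also have "\<dots> \<le> (p - p') \<bullet> h"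
    using order_trans[OF sum_mono[OF growth] wardrop_stationary_monotone[OF equilibrium_stationary equilibrium_stationary]]
    by (simp add: h_def)
  also have "\<dots> \<le> norm (p - p') * norm h" by (rule norm_cauchy_schwarz)
  finally have "(m * norm h) * norm h \<le> norm (p - p') * norm h" by (simp add: power2_eq_square mult_ac)
  then show ?thesis unfolding h_def[symmetric] by (cases "h = 0") auto
qed

end

section \<open>Sensitivity of the equilibrium to prices\<close>
lemma continuous_on_UNIV_tendsto_nhds: "continuous_on UNIV f \<Longrightarrow> (f \<longlongrightarrow> f x) (nhds x)"
  using tendsto_at_iff_tendsto_nhds[of f x] by (simp add: continuous_on_def)

locale smooth_evacuation_game = evacuation_game M c'
  for M :: "('z::finite, 'l::finite, 'n::finite) evacuation" and c' +
  fixes c'' :: "'z \<Rightarrow> real \<Rightarrow> real"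
  assumes cost_curvature_pos: "\<And>i v. v \<in> {0..max_rate M $ i} \<Longrightarrow> 0 < c'' i v"
    and marginal_deriv: "\<And>i v. v \<in> {0..max_rate M $ i} \<Longrightarrow>
      (c' i has_real_derivative c'' i v) (at v within {0..max_rate M $ i})"
    and curvature_continuous: "\<And>i. continuous_on {0..max_rate M $ i} (c'' i)"
begin

lemma curvature_lower_bound:
  obtains m where "0 < m" "\<And>i v. v \<in> {0..max_rate M $ i} \<Longrightarrow> m \<le> c'' i v"
proof -
  have "\<exists>x\<in>{0..max_rate M $ i}. \<forall>v\<in>{0..max_rate M $ i}. c'' i x \<le> c'' i v" for i
    by (rule continuous_attains_inf) (use max_rate_nonneg curvature_continuous in auto)
  then obtain x where x: "\<And>i. x i \<in> {0..max_rate M $ i}"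
      "\<And>i v. v \<in> {0..max_rate M $ i} \<Longrightarrow> c'' i (x i) \<le> c'' i v"
    by metis
  define m where "m = Min (range (\<lambda>i. c'' i (x i)))"
  have "0 < m" unfolding m_def using cost_curvature_pos[OF x(1)] by simp
  moreover have "m \<le> c'' i v" if "v \<in> {0..max_rate M $ i}" for i v
  proof -
    have "m \<le> c'' i (x i)" unfolding m_def by (intro Min_le) auto
    then show ?thesis using x(2)[OF that] by simp
  qed
  ultimately show ?thesis using that by blast
qed

lemma marginal_cost_strongly_monotone:
  assumes m: "\<And>v. v \<in> {0..max_rate M $ i} \<Longrightarrow> m \<le> c'' i v"
    and x: "x \<in> {0..max_rate M $ i}" and y: "y \<in> {0..max_rate M $ i}"
  shows "m * (x - y)\<^sup>2 \<le> (c' i x - c' i y) * (x - y)"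
proof -
  have ordered: "m * (b - a)\<^sup>2 \<le> (c' i b - c' i a) * (b - a)"
    if "a \<in> {0..max_rate M $ i}" "b \<in> {0..max_rate M $ i}" "a < b" for a b
  proof -
    have "\<exists>z\<in>{a<..<b}. c' i b - c' i a = (\<lambda>h. h * c'' i z) (b - a)"
    proof (rule mvt_simple[OF \<open>a < b\<close>])
      fix z assume "a \<le> z" "z \<le> b"
      then have "(c' i has_real_derivative c'' i z) (at z within {a..b})"
        using that by (intro DERIV_subset[OF marginal_deriv]) auto
      then show "(c' i has_derivative (\<lambda>h. h * c'' i z)) (at z within {a..b})"
        by (simp add: has_field_derivative_def mult_commute_abs)
    qed
    then obtain z where z: "z \<in> {a<..<b}" "c' i b - c' i a = (b - a) * c'' i z" by auto
    have "m * (b - a)\<^sup>2 \<le> c'' i z * (b - a)\<^sup>2"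
      using z(1) that by (intro mult_right_mono m) auto
    then show ?thesis unfolding z(2) by (simp add: power2_eq_square mult_ac)
  qed
  consider "x = y" | "x < y" | "y < x" by linarith
  then show ?thesis
  proof cases
    case 2
    have "m * (y - x)\<^sup>2 \<le> (c' i y - c' i x) * (y - x)" using ordered[OF x y 2] .
    then show ?thesis by (simp add: power2_commute[of x y] algebra_simps)
  qed (use ordered[OF y x] in simp_all)
qed

lemma equilibrium_lipschitz: "\<exists>L. L-lipschitz_on UNIV equilibrium"
proof -
  obtain m where m: "0 < m" "\<And>i v. v \<in> {0..max_rate M $ i} \<Longrightarrow> m \<le> c'' i v"
    using curvature_lower_bound by blast
  have "(1 / m)-lipschitz_on UNIV equilibrium"
  proof (rule lipschitz_onI)
    fix p p'
    have "m * norm (equilibrium p - equilibrium p') \<le> norm (p - p')"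
      by (intro equilibrium_distance_bound marginal_cost_strongly_monotone m rate_boxD equilibrium_in_rate_box)
    then show "dist (equilibrium p) (equilibrium p') \<le> 1 / m * dist p p'"
      using m(1) by (simp add: dist_norm pos_le_divide_eq mult.commute)
  qed (use m(1) in simp)
  then show ?thesis by blast
qed

lemma equilibrium_tendsto: "(equilibrium \<longlongrightarrow> equilibrium p) (nhds p)"
proof -
  have "continuous_on UNIV equilibrium"
    using equilibrium_lipschitz lipschitz_on_continuous_on by blast
  then show ?thesis by (rule continuous_on_UNIV_tendsto_nhds)
qed

text \<open>
  First-order expansion of the marginal costs along the equilibrium map, with an error relative to the
  displacement of the rates. The one-sided derivatives at the faces suffice because equilibria never
  leave the box.
\<close>
lemma marginal_expansion_at_equilibrium:
  assumes "0 < e"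
  shows "\<forall>\<^sub>F p' in nhds p. \<forall>i.
    \<bar>c' i (equilibrium p' $ i) - c' i (equilibrium p $ i)
      - c'' i (equilibrium p $ i) * (equilibrium p' $ i - equilibrium p $ i)\<bar>
    \<le> e * \<bar>equilibrium p' $ i - equilibrium p $ i\<bar>"
proof (rule eventually_all_finite)
  fix i
  define x where "x = equilibrium p $ i"
  have "(c' i has_derivative (\<lambda>h. c'' i x * h)) (at x within {0..max_rate M $ i})"
    using marginal_deriv[OF rate_boxD[OF equilibrium_in_rate_box[of p]], of i]
    by (simp add: has_field_derivative_def x_def)
  then obtain d where d: "0 < d" "\<And>y. y \<in> {0..max_rate M $ i} \<Longrightarrow> \<bar>y - x\<bar> < d \<Longrightarrow>
      \<bar>c' i y - c' i x - c'' i x * (y - x)\<bar> \<le> e * \<bar>y - x\<bar>"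
    unfolding has_derivative_within_alt real_norm_def using \<open>0 < e\<close> by blast
  have "((\<lambda>p'. equilibrium p' $ i) \<longlongrightarrow> x) (nhds p)"
    unfolding x_def by (intro tendsto_vec_nth equilibrium_tendsto)
  then have "\<forall>\<^sub>F p' in nhds p. dist (equilibrium p' $ i) x < d" using d(1) by (rule tendstoD)
  then show "\<forall>\<^sub>F p' in nhds p. \<bar>c' i (equilibrium p' $ i) - c' i (equilibrium p $ i)
      - c'' i (equilibrium p $ i) * (equilibrium p' $ i - equilibrium p $ i)\<bar>
    \<le> e * \<bar>equilibrium p' $ i - equilibrium p $ i\<bar>"
  proof eventually_elim
    case (elim p')
    then show ?case
      using d(2)[OF rate_boxD[OF equilibrium_in_rate_box]] by (simp add: x_def dist_real_def)
  qed
qed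

text \<open>
  For prices close to \<open>p\<close> the marginal costs grow at least with slope \<open>m - e\<close>, hence \<open>1 / (m - e)\<close> is a
  local Lipschitz constant at \<open>p\<close>; let \<open>e\<close> tend to zero.
\<close>
lemma onorm_equilibrium_derivative_le_min_curvature:
  assumes D: "(equilibrium has_derivative D) (at p)" and "0 < m"
    and m: "\<And>i. m \<le> c'' i (equilibrium p $ i)"
  shows "onorm D \<le> 1 / m"
proof -
  have approx: "onorm D \<le> 1 / (m - e)" if e: "0 < e" "e < m" for e
  proof (rule onorm_derivative_le_local_lipschitz[OF D])
    show "\<forall>\<^sub>F p' in nhds p. norm (equilibrium p' - equilibrium p) \<le> 1 / (m - e) * norm (p' - p)"
      using marginal_expansion_at_equilibrium[OF e(1), of p]
    proof eventually_elim
      case (elim p')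
      have "(m - e) * (equilibrium p' $ i - equilibrium p $ i)\<^sup>2 \<le>
        (c' i (equilibrium p' $ i) - c' i (equilibrium p $ i)) * (equilibrium p' $ i - equilibrium p $ i)" for i
      proof -
        define h r where "h = equilibrium p' $ i - equilibrium p $ i"
          and "r = c' i (equilibrium p' $ i) - c' i (equilibrium p $ i) - c'' i (equilibrium p $ i) * h"
        have "\<bar>r\<bar> * \<bar>h\<bar> \<le> (e * \<bar>h\<bar>) * \<bar>h\<bar>"
          using elim unfolding r_def h_def by (intro mult_right_mono) auto
        then have "- (e * h\<^sup>2) \<le> r * h"
          using abs_ge_minus_self[of "r * h"] by (simp add: abs_mult power2_eq_square)
        moreover have "m * h\<^sup>2 \<le> c'' i (equilibrium p $ i) * h\<^sup>2" by (intro mult_right_mono m) simp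
        ultimately have "(m - e) * h\<^sup>2 \<le> (c'' i (equilibrium p $ i) * h + r) * h"
          by (simp add: power2_eq_square algebra_simps)
        then show ?thesis by (simp add: r_def h_def)
      qed
      then have "(m - e) * norm (equilibrium p' - equilibrium p) \<le> norm (p' - p)"
        by (rule equilibrium_distance_bound)
      then show ?case using e by (simp add: pos_le_divide_eq mult.commute)
    qed
  qed (use e in simp)
  have "onorm D * m \<le> 1"
  proof (rule ccontr)
    assume "\<not> onorm D * m \<le> 1"
    then have big: "1 < onorm D * m" by simp
    then have "0 < onorm D * m" by simp
    then have pos: "0 < onorm D" using \<open>0 < m\<close> by (rule zero_less_mult_pos2)
    \<comment> \<open>With this \<open>e\<close>, \<open>m - e\<close> is the midpoint of \<open>1 / \<parallel>D\<parallel>\<close> and \<open>m\<close>; it still exceeds \<open>1 / \<parallel>D\<parallel>\<close>.\<close>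
    define q where "q = inverse (onorm D)"
    define e where "e = (m - q) / 2"
    have "0 < q" "q < m" using big pos by (simp_all add: q_def inverse_less_iff_less field_simps)
    then have e_pos: "0 < e" and e_less: "e < m" by (simp_all add: e_def)
    have "onorm D * (m - e) \<le> 1" using approx[OF e_pos e_less] e_less by (simp add: pos_le_divide_eq)
    moreover have "onorm D * (m - e) = (onorm D * m + 1) / 2" using pos by (simp add: e_def q_def field_simps)
    ultimately show False using big by simp
  qed
  then show ?thesis using \<open>0 < m\<close> by (simp add: pos_le_divide_eq)
qed

text \<open>
  At the unit vector of the zone with the smallest curvature, the form of \<open>\<Gamma> - H\<close> is at most that
  curvature, since \<open>H\<close> only lowers it. The norm of the inverse is therefore at least the reciprocal
  of the smallest curvature, which already bounds the derivative.
\<close>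
lemma onorm_equilibrium_derivative_le_op_norm_inverse:
  assumes D: "(equilibrium has_derivative D) (at p)"
    and pd: "pos_definite (cost_hessian c'' (equilibrium p) - H)" and H: "pos_semidef H"
  shows "onorm D \<le> op_norm (matrix_inv (cost_hessian c'' (equilibrium p) - H))"
proof -
  define d where "d i = c'' i (equilibrium p $ i)" for i
  have dpos: "0 < d i" for i
    unfolding d_def by (intro cost_curvature_pos rate_boxD equilibrium_in_rate_box)
  obtain k where k: "\<And>i. d k \<le> d i"
    using ex_min_if_finite[of "range d"] by (metis UNIV_I finite_class.finite_UNIV finite_imageI image_iff linorder_not_less empty_iff)
  define e where "e = (axis k 1 :: real ^ 'z)"
  have "norm e = 1" by (simp add: e_def)
  define A where "A = cost_hessian c'' (equilibrium p) - H"
  have "e \<bullet> (A *v e) \<le> d k"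
  proof -
    have "e \<bullet> (cost_hessian c'' (equilibrium p) *v e) = d k"
      unfolding e_def inner_axis' cost_hessian_def diag_mat_mult by (simp add: d_def)
    moreover have "0 \<le> e \<bullet> (H *v e)" using H by (simp add: pos_semidef_def)
    ultimately show ?thesis by (simp add: A_def matrix_vector_mult_diff_rdistrib inner_diff_right)
  qed
  moreover have "0 \<le> op_norm (matrix_inv A)"
    unfolding op_norm_def by (intro onorm_pos_le matrix_vector_mul_bounded_linear)
  ultimately have "1 \<le> d k * op_norm (matrix_inv A)"
    using one_le_quadratic_form_times_op_norm_inverse[OF pd \<open>norm e = 1\<close>]
      mult_right_mono[of "e \<bullet> (A *v e)" "d k" "op_norm (matrix_inv A)"]
    by (simp add: A_def)
  then have "1 / d k \<le> op_norm (matrix_inv A)" using dpos[of k] by (simp add: divide_le_eq mult.commute)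
  moreover have "onorm D \<le> 1 / d k"
    using onorm_equilibrium_derivative_le_min_curvature[OF D dpos[of k]] k by (simp add: d_def)
  ultimately show ?thesis by (simp add: A_def)
qed

text \<open>
  For nearby prices the displacement \<open>h\<close> of the rates vanishes on the saturated zones and solves
  \<open>c\<^sub>i''(u\<^sub>i) h\<^sub>i + (Hh)\<^sub>i = (p' - p)\<^sub>i\<close> up to an error \<open>o(\<parallel>h\<parallel>)\<close> on the other ones. Since the equilibrium
  map is already known to be Lipschitz, that error is \<open>o(\<parallel>p' - p\<parallel>)\<close> and applying the inverse of the
  linear system gives the derivative, without an implicit function theorem.
\<close>
lemma equilibrium_differentiable:
  assumes cong: "congested M (load M (equilibrium p))"
    and strict: "strictly_complementary M c' p (equilibrium p)"
  shows "equilibrium differentiable (at p)"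
proof -
  define u where "u = equilibrium p"
  define J where "J = {i. 0 < u $ i \<and> u $ i < max_rate M $ i}"
  define \<Gamma> where "\<Gamma> = cost_hessian c'' u"
  define H where "H = congestion_hessian M (load M u)"
  \<comment> \<open>The rows of \<open>\<Gamma> + H\<close> for the interior zones \<open>J\<close>, completed by rows of the identity.\<close>
  define B where "B = (\<chi> i j. if i \<in> J then (\<Gamma> + H) $ i $ j else (mat 1 :: real ^ 'z ^ 'z) $ i $ j)"
  define P where "P h = (\<chi> i. if i \<in> J then h $ i else 0)" for h :: "real ^ 'z"
  have ubox: "u $ i \<in> {0..max_rate M $ i}" for i
    unfolding u_def by (intro rate_boxD equilibrium_in_rate_box)
  have B_mult: "(B *v x) $ i = (if i \<in> J then c'' i (u $ i) * x $ i + (H *v x) $ i else x $ i)" for x i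
  proof (cases "i \<in> J")
    case True
    then have "(B *v x) $ i = ((\<Gamma> + H) *v x) $ i" by (simp add: B_def matrix_vector_mult_def)
    then show ?thesis
      using True by (simp add: matrix_vector_mult_add_rdistrib \<Gamma>_def cost_hessian_def diag_mat_mult)
  next
    case False
    then have "(B *v x) $ i = ((mat 1 :: real ^ 'z ^ 'z) *v x) $ i"
      unfolding B_def by (simp only: matrix_vector_mult_def vec_lambda_beta if_False)
    then show ?thesis using False by simp
  qed
  have H: "pos_semidef H" unfolding H_def by (intro congestion_hessian_pos_semidef penalty_nonneg)
  have "invertible B"
    unfolding invertible_left_inverse matrix_left_invertible_ker
  proof (intro allI impI)
    fix x assume Bx: "B *v x = 0"
    have off: "x $ i = 0" if "i \<notin> J" for i using B_mult[of x i] that Bx by simp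
    have "c'' i (u $ i) * (x $ i)\<^sup>2 + x $ i * (H *v x) $ i = 0" for i
      using B_mult[of x i] Bx off[of i]
      by (cases "i \<in> J") (auto simp: power2_eq_square distrib_left[symmetric] mult_ac)
    then have "(\<Sum>i\<in>UNIV. c'' i (u $ i) * (x $ i)\<^sup>2) + x \<bullet> (H *v x) = 0"
      by (simp add: inner_vec_def sum.distrib[symmetric])
    moreover have "0 \<le> x \<bullet> (H *v x)" using H by (simp add: pos_semidef_def)
    moreover have nonneg: "0 \<le> c'' i (u $ i) * (x $ i)\<^sup>2" for i
      using cost_curvature_pos[OF ubox[of i]] by simp
    then have "0 \<le> (\<Sum>i\<in>UNIV. c'' i (u $ i) * (x $ i)\<^sup>2)" by (intro sum_nonneg) auto
    ultimately have "(\<Sum>i\<in>UNIV. c'' i (u $ i) * (x $ i)\<^sup>2) = 0" by linarith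
    then have "c'' i (u $ i) * (x $ i)\<^sup>2 = 0" for i
      using sum_nonneg_eq_0_iff[of UNIV "\<lambda>i. c'' i (u $ i) * (x $ i)\<^sup>2"] nonneg by simp
    then have "x $ i = 0" for i
      using cost_curvature_pos[OF ubox[of i]] by (metis less_irrefl mult_eq_0_iff power_eq_0_iff)
    then show "x = 0" by (simp add: vec_eq_iff)
  qed
  then have Binv: "matrix_inv B *v (B *v x) = x" for x
    by (simp add: matrix_vector_mul_assoc matrix_inv_inverse(2))
  define D where "D h = matrix_inv B *v P h" for h
  have "bounded_linear P"
    unfolding linear_conv_bounded_linear[symmetric]
    by (rule linearI) (simp_all add: P_def vec_eq_iff)
  then have "bounded_linear D"
    unfolding D_def by (rule bounded_linear_compose[OF matrix_vector_mul_bounded_linear])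
  have nth_tendsto: "((\<lambda>p'. equilibrium p' $ i) \<longlongrightarrow> u $ i) (nhds p)" for i
    unfolding u_def by (intro tendsto_vec_nth equilibrium_tendsto)
  have load_tendsto: "((\<lambda>p'. load M (equilibrium p') $ l) \<longlongrightarrow> load M u $ l) (nhds p)" for l
    unfolding load_nth by (intro tendsto_intros nth_tendsto)
  have stays_congested: "\<forall>\<^sub>F p' in nhds p. \<forall>l. capacity M $ l < load M (equilibrium p') $ l"
    by (intro eventually_all_finite order_tendstoD(1)[OF load_tendsto])
      (use cong in \<open>auto simp: congested_def u_def\<close>)
  have gradient_tendsto: "((\<lambda>p'. beckmann_gradient M c' p' (equilibrium p') $ i)
      \<longlongrightarrow> beckmann_gradient M c' p u $ i) (nhds p)" for i
  proof -
    have "continuous_on UNIV equilibrium"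
      using equilibrium_lipschitz lipschitz_on_continuous_on by blast
    then have "continuous_on UNIV (\<lambda>p'. beckmann_gradient M c' 0 (equilibrium p'))"
      by (rule continuous_on_compose2[OF beckmann_gradient_continuous]) (use equilibrium_in_rate_box in auto)
    then have "((\<lambda>p'. beckmann_gradient M c' 0 (equilibrium p')) \<longlongrightarrow> beckmann_gradient M c' 0 u) (nhds p)"
      unfolding u_def by (rule continuous_on_UNIV_tendsto_nhds)
    then have "((\<lambda>p'. beckmann_gradient M c' 0 (equilibrium p') $ i - p' $ i)
        \<longlongrightarrow> beckmann_gradient M c' 0 u $ i - p $ i) (nhds p)"
      by (intro tendsto_intros) (auto simp: filterlim_ident)
    then show ?thesis by (simp add: beckmann_gradient_def)
  qed
  have stationary: "(x $ i < max_rate M $ i \<longrightarrow> 0 \<le> beckmann_gradient M c' q x $ i) \<and>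
      (0 < x $ i \<longrightarrow> beckmann_gradient M c' q x $ i \<le> 0)" if "x = equilibrium q" for q x i
    using equilibrium_stationary[of q] that by (simp add: wardrop_stationary_def beckmann_gradient_def)
  have saturated: "\<forall>\<^sub>F p' in nhds p. equilibrium p' $ i = u $ i" if "i \<notin> J" for i
  proof -
    have box': "equilibrium q $ i \<in> {0..max_rate M $ i}" for q
      by (intro rate_boxD equilibrium_in_rate_box)
    have face: "u $ i = 0 \<or> u $ i = max_rate M $ i" using that ubox[of i] by (auto simp: J_def)
    have nonzero: "beckmann_gradient M c' p u $ i \<noteq> 0"
    proof -
      from face have "c' i (u $ i) + congestion_price M (load M u) i \<noteq> p $ i"
        using strict unfolding strictly_complementary_def u_def by blast
      then show ?thesis by (simp add: beckmann_gradient_def)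
    qed
    \<comment> \<open>Where the box is a single point the gradient may have either sign, but the rate is constant.\<close>
    consider "max_rate M $ i = 0" | "u $ i = 0" "0 < max_rate M $ i"
      | "u $ i = max_rate M $ i" "0 < max_rate M $ i"
      using face max_rate_nonneg[of i] by (auto simp: le_less)
    then show ?thesis
    proof cases
      case 1
      then show ?thesis using box' ubox[of i] by simp
    next
      case 2
      then have "0 < beckmann_gradient M c' p u $ i"
        using stationary[OF u_def, of i] nonzero by auto
      then have "\<forall>\<^sub>F p' in nhds p. 0 < beckmann_gradient M c' p' (equilibrium p') $ i"
        by (rule order_tendstoD(1)[OF gradient_tendsto])
      then show ?thesis
      proof eventually_elim
        case (elim p')
        then show ?case using stationary[OF refl, of p' i] box'[of p'] 2 by force
      qed
    next
      case 3
      then have "beckmann_gradient M c' p u $ i < 0"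
        using stationary[OF u_def, of i] nonzero by auto
      then have "\<forall>\<^sub>F p' in nhds p. beckmann_gradient M c' p' (equilibrium p') $ i < 0"
        by (rule order_tendstoD(2)[OF gradient_tendsto])
      then show ?thesis
      proof eventually_elim
        case (elim p')
        then show ?case using stationary[OF refl, of p' i] box'[of p'] 3 by force
      qed
    qed
  qed
  have interior: "\<forall>\<^sub>F p' in nhds p. 0 < equilibrium p' $ i \<and> equilibrium p' $ i < max_rate M $ i"
    if "i \<in> J" for i
    using that unfolding J_def
    by (intro eventually_conj order_tendstoD[OF nth_tendsto]) auto
  have "\<forall>\<^sub>F p' in nhds p. (i \<in> J \<longrightarrow> 0 < equilibrium p' $ i \<and> equilibrium p' $ i < max_rate M $ i) \<and>
      (i \<notin> J \<longrightarrow> equilibrium p' $ i = u $ i)" for i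
    by (cases "i \<in> J") (simp_all add: interior saturated)
  then have faces: "\<forall>\<^sub>F p' in nhds p. \<forall>i. (i \<in> J \<longrightarrow> 0 < equilibrium p' $ i \<and> equilibrium p' $ i < max_rate M $ i) \<and>
      (i \<notin> J \<longrightarrow> equilibrium p' $ i = u $ i)"
    by (rule eventually_all_finite)
  have linearised: "\<forall>\<^sub>F p' in nhds p. norm (B *v (equilibrium p' - u) - P (p' - p))
      \<le> e * norm (equilibrium p' - u)" if "0 < e" for e
    using faces stays_congested marginal_expansion_at_equilibrium[OF that, of p]
  proof eventually_elim
    case (elim p')
    define v where "v = equilibrium p'"
    have "\<bar>(B *v (v - u) - P (p' - p)) $ i\<bar> \<le> \<bar>(e *\<^sub>R (v - u)) $ i\<bar>" for i
    proof (cases "i \<in> J")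
      case True
      have "beckmann_gradient M c' p u $ i = 0"
        using stationary[OF u_def, of i] True by (auto simp: J_def)
      moreover have "beckmann_gradient M c' p' v $ i = 0"
        using stationary[OF v_def, of i] elim(1) True by (auto simp: v_def)
      ultimately have balance: "c' i (v $ i) - c' i (u $ i)
          + (congestion_price M (load M v) i - congestion_price M (load M u) i) = p' $ i - p $ i"
        by (simp add: beckmann_gradient_def)
      have "exposure M l (load M v $ l) - exposure M l (load M u $ l)
          = penalty M $ l * of_bool (capacity M $ l < load M u $ l) * load M (v - u) $ l" for l
        using cong elim(2)
        by (simp add: congested_def exposure_def load_diff[symmetric] u_def v_def max_def
            less_imp_le not_le[symmetric] right_diff_distrib[symmetric])
      then have "congestion_price M (load M v) i - congestion_price M (load M u) i = (H *v (v - u)) $ i"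
        by (simp add: congestion_price_def H_def congestion_hessian_mult vector_matrix_mult_def
            sum_subtractf[symmetric] right_diff_distrib[symmetric] mult.commute)
      then have "(B *v (v - u) - P (p' - p)) $ i
          = - (c' i (v $ i) - c' i (u $ i) - c'' i (u $ i) * (v $ i - u $ i))"
        using balance True by (simp add: B_mult P_def)
      then have "\<bar>(B *v (v - u) - P (p' - p)) $ i\<bar>
          = \<bar>c' i (v $ i) - c' i (u $ i) - c'' i (u $ i) * (v $ i - u $ i)\<bar>"
        by (simp only: abs_minus_cancel)
      then show ?thesis using elim(3) \<open>0 < e\<close> by (simp add: u_def v_def abs_mult)
    next
      case False
      then show ?thesis using elim(1) by (simp add: B_mult P_def v_def)
    qed
    then have "norm (B *v (v - u) - P (p' - p)) \<le> norm (e *\<^sub>R (v - u))"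
      by (intro norm_le_componentwise_cart) simp
    then show ?case using \<open>0 < e\<close> by (simp add: v_def)
  qed
  obtain L where L: "L-lipschitz_on UNIV equilibrium" using equilibrium_lipschitz by blast
  define K where "K = onorm ((*v) (matrix_inv B))"
  have "0 \<le> L" using L by (rule lipschitz_on_nonneg)
  have "0 \<le> K" unfolding K_def by (intro onorm_pos_le matrix_vector_mul_bounded_linear)
  have "(equilibrium has_derivative D) (at p)"
    unfolding has_derivative_iff_eventually_nhds
  proof (intro conjI allI impI \<open>bounded_linear D\<close>)
    fix e :: real assume "0 < e"
    define e' where "e' = e / (K * L + 1)"
    have "0 < K * L + 1" using \<open>0 \<le> K\<close> \<open>0 \<le> L\<close> by (simp add: add_nonneg_pos)
    then have "0 < e'" using \<open>0 < e\<close> by (simp add: e'_def)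
    have small: "K * e' * L \<le> e"
    proof -
      have "K * e' * L = e * (K * L / (K * L + 1))" by (simp add: e'_def)
      also have "\<dots> \<le> e * 1"
        using \<open>0 < e\<close> \<open>0 < K * L + 1\<close> by (intro mult_left_mono) (auto simp: divide_le_eq)
      finally show ?thesis by simp
    qed
    from linearised[OF \<open>0 < e'\<close>]
    show "\<forall>\<^sub>F p' in nhds p. norm (equilibrium p' - equilibrium p - D (p' - p)) \<le> e * norm (p' - p)"
    proof eventually_elim
      case (elim p')
      have "equilibrium p' - u - D (p' - p) = matrix_inv B *v (B *v (equilibrium p' - u) - P (p' - p))"
        by (simp only: matrix_vector_mult_diff_distrib[of "matrix_inv B"] Binv D_def)
      also have "norm \<dots> \<le> K * norm (B *v (equilibrium p' - u) - P (p' - p))"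
        unfolding K_def by (intro onorm matrix_vector_mul_bounded_linear)
      also have "\<dots> \<le> K * (e' * norm (equilibrium p' - u))" using \<open>0 \<le> K\<close> elim by (rule mult_left_mono[rotated])
      also have "\<dots> \<le> K * (e' * (L * norm (p' - p)))"
        using lipschitz_onD[OF L, of p' p] \<open>0 \<le> K\<close> \<open>0 < e'\<close>
        by (intro mult_left_mono) (auto simp: dist_norm u_def)
      also have "\<dots> = K * e' * L * norm (p' - p)" by simp
      also have "\<dots> \<le> e * norm (p' - p)" using small by (rule mult_right_mono) simp
      finally show ?case by (simp add: u_def)
    qed
  qed
  then show ?thesis by (auto simp: differentiable_def)
qed

text \<open>
  With \<open>\<lambda>\<close> the largest eigenvalue of the pencil, every occurrence of the spectral radius reads \<open>\<lambda>\<close>.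
\<close>
lemma congested_sensitivity:
  assumes cong: "congested M (load M (equilibrium p))"
    and \<Gamma>: "\<Gamma> = cost_hessian c'' (equilibrium p)"
    and H: "H = congestion_hessian M (load M (equilibrium p))"
  shows "(spectral_radius (matrix_inv \<Gamma> ** H) < 1 \<longrightarrow>
      (\<forall>D. (equilibrium has_derivative D) (at p) \<longrightarrow> onorm D \<le> op_norm (matrix_inv (\<Gamma> - H)))) \<and>
    (strictly_complementary M c' p (equilibrium p) \<longrightarrow> equilibrium differentiable (at p)) \<and>
    (neumann_converges (matrix_inv \<Gamma> ** H) \<longleftrightarrow> spectral_radius (matrix_inv \<Gamma> ** H) < 1) \<and>
    (spectral_radius (matrix_inv \<Gamma> ** H) \<le> 1 \<longrightarrow>
      (invertible (\<Gamma> - H) \<longleftrightarrow> spectral_radius (matrix_inv \<Gamma> ** H) < 1))"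
proof -
  have pd: "pos_definite \<Gamma>"
    unfolding \<Gamma>
    by (intro cost_hessian_pos_definite cost_curvature_pos rate_boxD equilibrium_in_rate_box)
  have psd: "pos_semidef H" unfolding H by (intro congestion_hessian_pos_semidef penalty_nonneg)
  obtain lam x0 where max: "max_pencil_eigenvalue \<Gamma> H lam x0"
    using max_pencil_eigenvalue_exists[OF pd psd] .
  have "onorm D \<le> op_norm (matrix_inv (\<Gamma> - H))"
    if "lam < 1" "(equilibrium has_derivative D) (at p)" for D
    using onorm_equilibrium_derivative_le_op_norm_inverse[OF that(2) _ psd]
      pencil_difference_pos_definite[OF pd psd max that(1)] by (simp add: \<Gamma>)
  then show ?thesis
    unfolding spectral_radius_pencil[OF pd psd max]
    using neumann_converges_pencil[OF pd psd max] invertible_pencil_difference[OF pd psd max]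
      equilibrium_differentiable[OF cong] by blast
qed

end

section \<open>The lower-level equilibrium\<close>

theorem lemma2:
  fixes M :: "('z::finite, 'l::finite, 'n::finite) evacuation"
    and c' :: "'z \<Rightarrow> real \<Rightarrow> real"
    and T :: real and K :: nat and tier :: "'z \<Rightarrow> nat"
    and \<alpha> :: "real \<Rightarrow> real ^ 'n ^ 'm::finite" and \<theta> :: "nat \<Rightarrow> real"
    and \<psi> :: "real \<Rightarrow> ('z, 'n) state \<Rightarrow> real ^ 'n"
    and belief_gen :: "(real \<Rightarrow> real ^ 'n ^ 'm) \<Rightarrow> (real \<Rightarrow> ('z, 'n) state \<Rightarrow> real ^ 'n) \<Rightarrow>
      (real \<Rightarrow> ('z, 'n) state \<Rightarrow> real) \<Rightarrow> real \<Rightarrow> ('z, 'n) state \<Rightarrow> real"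
  assumes routing_nonneg: "\<And>l i. 0 \<le> routing M $ l $ i"
    and penalty_pos: "\<And>l. 0 < penalty M $ l"
    and max_rate_nonneg: "\<And>i. 0 \<le> max_rate M $ i"
    and risk_aversion_pos: "\<And>i. 0 < risk_aversion M $ i"
    and hazard_nonneg: "\<And>i X. 0 \<le> hazard M i X"
    and policy: "admissible_policy T K (\<alpha>, \<theta>)"
    and tiers: "\<And>i. tier i \<in> {1..K}"
    and cost_zero: "\<And>i. mob_cost M i 0 = 0"
    and cost_deriv: "\<And>i v. v \<in> {0..max_rate M $ i} \<Longrightarrow>
      (mob_cost M i has_real_derivative c' i v) (at v within {0..max_rate M $ i})"
    and cost_C1: "\<And>i. continuous_on {0..max_rate M $ i} (c' i)"
    and cost_incr: "\<And>i v. v \<in> {0<..max_rate M $ i} \<Longrightarrow> 0 < c' i v"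
    and cost_convex: "\<And>i. strictly_convex_on {0..max_rate M $ i} (mob_cost M i)"
  shows "\<exists>ustar :: real \<Rightarrow> ('z, 'n) state \<Rightarrow> real ^ 'z \<Rightarrow> real ^ 'z.
    (\<forall>t\<in>{0..T}. \<forall>w\<in>state_space.
      (\<forall>V G u. (\<forall>i. has_backlog_gradient (V i) (G i) t w) \<longrightarrow>
        (wardrop_equilibrium M (activation \<theta> tier) (\<lambda>i. belief_gen \<alpha> \<psi> (V i) t w) t w G u
          \<longleftrightarrow> u = ustar t w (\<chi> i. G i $ i))) \<and>
      (\<forall>p.
        (\<forall>u. wardrop_stationary M c' p u \<longleftrightarrow> u = ustar t w p) \<and>
        strictly_convex_on (rate_box M) (beckmann_objective M p) \<and>
        (\<forall>u. is_arg_min (beckmann_objective M p) (\<lambda>v. v \<in> rate_box M) u \<longleftrightarrow> u = ustar t w p) \<and>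
        (\<forall>i. ustar t w p $ i =
          box_proj (max_rate M $ i) (marginal_inverse (c' i) (max_rate M $ i)
            (p $ i - congestion_price M (load M (ustar t w p)) i))))) \<and>
    (\<forall>c''. (\<forall>i. \<forall>v\<in>{0..max_rate M $ i}. 0 < c'' i v \<and>
             (c' i has_real_derivative c'' i v) (at v within {0..max_rate M $ i})) \<and>
           (\<forall>i. continuous_on {0..max_rate M $ i} (c'' i)) \<longrightarrow>
      (\<exists>L. \<forall>t\<in>{0..T}. \<forall>w\<in>state_space. L-lipschitz_on UNIV (ustar t w)) \<and>
      (\<forall>t\<in>{0..T}. \<forall>w\<in>state_space. \<forall>p \<Gamma> H.
        congested M (load M (ustar t w p)) \<and>
        \<Gamma> = cost_hessian c'' (ustar t w p) \<and>
        H = congestion_hessian M (load M (ustar t w p)) \<longrightarrow>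
          (spectral_radius (matrix_inv \<Gamma> ** H) < 1 \<longrightarrow>
            (\<forall>D. (ustar t w has_derivative D) (at p) \<longrightarrow>
              onorm D \<le> op_norm (matrix_inv (\<Gamma> - H)))) \<and>
          (strictly_complementary M c' p (ustar t w p) \<longrightarrow> ustar t w differentiable (at p)) \<and>
          (neumann_converges (matrix_inv \<Gamma> ** H) \<longleftrightarrow> spectral_radius (matrix_inv \<Gamma> ** H) < 1) \<and>
          (spectral_radius (matrix_inv \<Gamma> ** H) \<le> 1 \<longrightarrow>
            (invertible (\<Gamma> - H) \<longleftrightarrow> spectral_radius (matrix_inv \<Gamma> ** H) < 1))))"
proof -
  interpret evacuation_game M c'
    by unfold_locales (use assms in \<open>auto simp: less_imp_le\<close>)
  have equilibrium_facts:
    "wardrop_equilibrium M (activation \<theta> tier) (\<lambda>i. belief_gen \<alpha> \<psi> (V i) t w) t w G u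
      \<longleftrightarrow> u = equilibrium (\<chi> i. G i $ i)"
    "wardrop_stationary M c' p u \<longleftrightarrow> u = equilibrium p"
    "strictly_convex_on (rate_box M) (beckmann_objective M p)"
    "is_arg_min (beckmann_objective M p) (\<lambda>v. v \<in> rate_box M) u \<longleftrightarrow> u = equilibrium p"
    "equilibrium p $ i = box_proj (max_rate M $ i) (marginal_inverse (c' i) (max_rate M $ i)
      (p $ i - congestion_price M (load M (equilibrium p)) i))"
    for V :: "'z \<Rightarrow> real \<Rightarrow> ('z, 'n) state \<Rightarrow> real" and t w G u p i
    unfolding wardrop_equilibrium_iff_stationary is_arg_min_iff_wardrop_stationary
    by (rule wardrop_stationary_iff_equilibrium beckmann_objective_strictly_convex
        wardrop_stationary_saturated_feedback[OF equilibrium_stationary])+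
  \<comment> \<open>Time and state enter the zone Hamiltonians only through terms without the zone's own rate,
    so one map of the prices serves for all of them.\<close>
  show ?thesis
    apply (rule exI[of _ "\<lambda>t w. equilibrium"], rule conjI)
    subgoal by (intro ballI conjI allI impI equilibrium_facts)
    subgoal
      apply (intro allI impI)
      subgoal premises smooth for c''
      proof -
        interpret smooth_evacuation_game M c' c''
          by unfold_locales (use smooth in auto)
        have "\<exists>L. \<forall>t\<in>{0..T}. \<forall>w\<in>state_space. L-lipschitz_on UNIV equilibrium"
          using equilibrium_lipschitz by blast
        then show ?thesis
          by (rule conjI) (intro ballI allI impI, elim conjE, rule congested_sensitivity)
      qed
      done
    done
qed

end
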